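(* Let $r$ be a positive integer and set $\varepsilon=(-1)^{r+1}$. (1) Let $v$ be an integer with $2^rv^2\equiv-\varepsilon\pmod3$ and set $x=\frac{2^rv^2+\varepsilon}{3}$. Then the discriminant module of the even nondegenerate lattice with Gram matrix $\begin{pmatrix}2^{r+1}&2^r&0&0\\2^r&2^{r+1}&2^rv&0\\0&2^rv&2x&1\\0&0&1&\varepsilon\cdot2\end{pmatrix}$ is isometrically isomorphic to $\underline{B}_{2^r}$, and no even nondegenerate lattice of smaller rank has discriminant module isometrically isomorphic to $\underline{B}_{2^r}$. (2) The discriminant module of the even nondegenerate lattice with Gram matrix $\begin{pmatrix}0&2^r\\2^r&0\end{pmatrix}$ is isometrically isomorphic to $\underline{C}_{2^r}$, and no even nondegenerate lattice of smaller rank has discriminant module isometrically isomorphic to $\underline{C}_{2^r}$.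
   Context: A lattice $(L,B)$ is a free $\mathbb{Z}$-module $L$ of finite rank with a symmetric bilinear form $B\colon L\times L\to\mathbb{R}$; nondegenerate means its Gram matrix with respect to a basis has nonzero determinant; even means $B(x,y)\in\mathbb{Z}$ and $B(x,x)\in2\mathbb{Z}$ for all $x,y$. The lattice with Gram matrix $G$ is $\mathbb{Z}^n$ with $B(x,y)=x^{\mathrm T}Gy$. Dual lattice $L^\sharp=\{v\in\mathbb{R}\otimes L: B(v,w)\in\mathbb{Z}\ \forall w\in L\}$; discriminant module of an even nondegenerate lattice: $D_L=(L^\sharp/L,\ v+L\mapsto\frac12B(v,v)+\mathbb{Z})$. Finite quadratic modules are finite abelian groups with $Q\colon M\to\mathbb{Q}/\mathbb{Z}$, $Q(nx)=n^2Q(x)$, with $Q(x+y)-Q(x)-Q(y)$ bilinear nondegenerate; isometric isomorphisms are group isomorphisms preserving $Q$. $\underline{B}_{2^r}=((\mathbb{Z}/2^r\mathbb{Z})^2,\ (x,y)\mapsto\frac{x^2+xy+y^2}{2^r}+\mathbb{Z})$, $\underline{C}_{2^r}=((\mathbb{Z}/2^r\mathbb{Z})^2,\ (x,y)\mapsto\frac{xy}{2^r}+\mathbb{Z})$. *)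

theory Defs
  imports
    "HOL-Analysis.Analysis"
    "HOL-Algebra.Elementary_Groups"
    "HOL-Number_Theory.Cong"
    "Jordan_Normal_Form.Determinant"
begin

no_notation vec_index (infixl "$" 100)
hide_const (open) Matrix.vec Matrix.mat_of_rows Determinant.det

text \<open>
  A free \<open>\<int>\<close>-module of finite rank is represented inside its scalar extension to the reals: it is
  the set of integral combinations of a finite linearly independent family in some real vector
  space, and \<open>\<real> \<otimes> L\<close> is \<^term>\<open>span L\<close>. The form \<open>B\<close> is given together with an \<open>\<real>\<close>-bilinear extension
  to the ambient space; only its values on \<^term>\<open>span L\<close>, which are determined by those on \<open>L\<close>,
  are ever used.
\<close>

definition lattice_basis :: "'v::real_vector set \<Rightarrow> 'v list \<Rightarrow> bool" where
  "lattice_basis L bs \<longleftrightarrow> distinct bs \<and> independent (set bs) \<and>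
     L = {\<Sum>i<length bs. of_int (c i) *\<^sub>R (bs ! i) |c :: nat \<Rightarrow> int. True}"

definition is_lattice :: "'v::real_vector set \<Rightarrow> ('v \<Rightarrow> 'v \<Rightarrow> real) \<Rightarrow> bool" where
  "is_lattice L B \<longleftrightarrow> (\<exists>bs. lattice_basis L bs) \<and> bilinear B \<and> (\<forall>x y. B x y = B y x)"

definition lattice_rank :: "'v::real_vector set \<Rightarrow> nat" where
  "lattice_rank L = (THE n. \<exists>bs. lattice_basis L bs \<and> length bs = n)"

lemma lattice_basis_length:
  assumes "lattice_basis L bs"
  shows "length bs = dim L"
proof -
  have ind: "independent (set bs)" and dis: "distinct bs"
    and L: "L = {\<Sum>i<length bs. of_int (c i) *\<^sub>R (bs ! i) |c :: nat \<Rightarrow> int. True}"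
    using assms by (auto simp: lattice_basis_def)
  have "set bs \<subseteq> L"
  proof
    fix b assume "b \<in> set bs"
    then obtain j where j: "j < length bs" "b = bs ! j"
      by (auto simp: in_set_conv_nth)
    have "(\<Sum>i<length bs. of_int (if i = j then 1 else 0) *\<^sub>R (bs ! i))
        = (\<Sum>i<length bs. if i = j then bs ! i else 0)"
      by (intro sum.cong) auto
    also have "\<dots> = b" using j by simp
    finally show "b \<in> L"
      unfolding L by (auto intro!: exI[of _ "\<lambda>i. if i = j then 1 else (0::int)"])
  qed
  moreover have "L \<subseteq> span (set bs)"
    unfolding L by (auto intro!: span_sum span_scale intro: span_base)
  ultimately show ?thesis
    using ind dis by (metis basis_card_eq_dim distinct_card)
qed

lemma lattice_rank_eq: "lattice_basis L bs \<Longrightarrow> lattice_rank L = length bs"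
  unfolding lattice_rank_def by (rule the_equality) (auto simp: lattice_basis_length)

definition gram_matrix :: "('v \<Rightarrow> 'v \<Rightarrow> real) \<Rightarrow> 'v list \<Rightarrow> real mat" where
  "gram_matrix B bs = Matrix.mat (length bs) (length bs) (\<lambda>(i, j). B (bs ! i) (bs ! j))"

definition nondegenerate :: "'v::real_vector set \<Rightarrow> ('v \<Rightarrow> 'v \<Rightarrow> real) \<Rightarrow> bool" where
  "nondegenerate L B \<longleftrightarrow> (\<exists>bs. lattice_basis L bs \<and> Determinant.det (gram_matrix B bs) \<noteq> 0)"

definition even_form :: "'v set \<Rightarrow> ('v \<Rightarrow> 'v \<Rightarrow> real) \<Rightarrow> bool" where
  "even_form L B \<longleftrightarrow> (\<forall>x\<in>L. \<forall>y\<in>L. B x y \<in> \<int>) \<and> (\<forall>x\<in>L. \<exists>k::int. B x x = 2 * of_int k)"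

definition even_nondegenerate_lattice :: "'v::real_vector set \<Rightarrow> ('v \<Rightarrow> 'v \<Rightarrow> real) \<Rightarrow> bool" where
  "even_nondegenerate_lattice L B \<longleftrightarrow> is_lattice L B \<and> even_form L B \<and> nondegenerate L B"

definition standard_lattice :: "(real^'n) set" where
  "standard_lattice = {x. \<forall>i. x $ i \<in> \<int>}"

definition gram_form :: "real^'n^'n \<Rightarrow> real^'n \<Rightarrow> real^'n \<Rightarrow> real" where
  "gram_form G x y = x \<bullet> (G *v y)"

definition dual_lattice :: "'v::real_vector set \<Rightarrow> ('v \<Rightarrow> 'v \<Rightarrow> real) \<Rightarrow> 'v set" where
  "dual_lattice L B = {v \<in> span L. \<forall>w\<in>L. B v w \<in> \<int>}"

definition mod_one :: "real \<Rightarrow> real set" where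
  "mod_one t = {t + of_int k |k. True}"

text \<open>
  A quadratic module is a pair of a group (written multiplicatively) and a
  map into \<open>\<rat>/\<int>\<close>, whose elements are cosets \<^term>\<open>mod_one t\<close>.
\<close>

type_synonym 'a quadratic_module = "'a monoid \<times> ('a \<Rightarrow> real set)"

definition isometrically_isomorphic :: "'a quadratic_module \<Rightarrow> 'b quadratic_module \<Rightarrow> bool" where
  "isometrically_isomorphic M N \<longleftrightarrow>
     (\<exists>f \<in> iso (fst M) (fst N). \<forall>x \<in> carrier (fst M). snd N (f x) = snd M x)"

text \<open>
  In an even lattice \<open>B v v / 2 + \<int>\<close> does not depend on the representative \<open>v\<close> of a coset \<open>X\<close> in the
  dual modulo \<open>L\<close>, so the union below is that single class.
\<close>

definition discriminant_module ::
  "'v::real_vector set \<Rightarrow> ('v \<Rightarrow> 'v \<Rightarrow> real) \<Rightarrow> 'v set quadratic_module" where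
  "discriminant_module L B =
     (\<lparr>carrier = dual_lattice L B, monoid.mult = (+), one = 0\<rparr> Mod L,
      \<lambda>X. \<Union>v\<in>X. mod_one (B v v / 2))"

definition module_B :: "nat \<Rightarrow> (int \<times> int) quadratic_module" where
  "module_B n = (integer_mod_group n \<times>\<times> integer_mod_group n,
     \<lambda>(x, y). mod_one (of_int (x\<^sup>2 + x * y + y\<^sup>2) / of_nat n))"

definition module_C :: "nat \<Rightarrow> (int \<times> int) quadratic_module" where
  "module_C n = (integer_mod_group n \<times>\<times> integer_mod_group n,
     \<lambda>(x, y). mod_one (of_int (x * y) / of_nat n))"

end

theory Submission
  imports Defs
begin

text \<open>
  An isometry of a discriminant module with a form \<open>\<phi>(x, y)/q\<close> on \<open>(\<int>/q)\<^sup>2\<close> amounts to two vectors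
  of the dual lattice that generate it modulo \<open>L\<close> with relations \<open>q\<close> and have the prescribed norms.
  For the given Gram matrices \<open>e\<^sub>1/q\<close> and \<open>e\<^sub>2/q\<close> are such vectors. For minimality, multiplication by 2
  identifies the 2-torsion of the discriminant group with the radical of the form modulo 2 on
  \<open>L/2L\<close>. This radical has dimension 2, so the rank is at least 2, and since the form of an even
  lattice is alternating modulo 2, the rank is even. In rank 2 the Gram matrix is \<open>2\<^sup>r\<close> times an even
  unimodular matrix, whose form is isotropic modulo 2, unlike \<open>x\<^sup>2 + xy + y\<^sup>2\<close>.
\<close>

text \<open>The block on the first two coordinates of the rank 4 matrix is \<open>q\<close> times
  the Gram matrix of A2. It supplies the form (x^2 + xy + y^2)/q, but on its own it has determinant
  3 q^2 and so unwanted 3-torsion in the discriminant group. The last two coordinates remove it: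
  since 3x - q v^2 = \<epsilon>, the Schur complement of the block has determinant 1/3, and the
  whole determinant is q^2. The congruence on v makes x an integer; as 2^r is (-1)^r modulo 3, the
  chosen sign \<epsilon> turns it into v^2 = 1 modulo 3, while the opposite sign would ask for a
  square congruent to -1. The lower bounds avoid relating the Gram determinant to the order of the
  discriminant group. Independence modulo 2 becomes a parity statement about coordinates, and the
  unimodular factor in rank 2 is found from the fact that \<open>q\<close> annihilates the
  discriminant group. Rank 3 fails because an alternating form with a radical of dimension 2 in
  dimension 3 is zero, which would enlarge the radical to dimension 3.\<close>

lemma mod_one_eq_iff: "mod_one s = mod_one t \<longleftrightarrow> s - t \<in> \<int>"
proof
  assume "mod_one s = mod_one t"
  moreover have "s \<in> mod_one s"
    unfolding mod_one_def by (auto intro: exI[of _ 0])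
  ultimately obtain k where "s = t + of_int k"
    unfolding mod_one_def by auto
  then show "s - t \<in> \<int>"
    by simp
next
  assume "s - t \<in> \<int>"
  then obtain k where s: "s = t + of_int k"
    by (metis Ints_cases add.commute diff_add_cancel)
  have "t + of_int j = s + of_int (j - k)" for j :: int
    by (simp add: s)
  moreover have "s + of_int j = t + of_int (j + k)" for j :: int
    by (simp add: s)
  ultimately show "mod_one s = mod_one t"
    unfolding mod_one_def by blast
qed

section \<open>Coordinates with respect to a lattice basis\<close>

lemma lattice_basis_sum_eq_0:
  assumes "lattice_basis L bs" and "(\<Sum>i<length bs. x i *\<^sub>R (bs ! i)) = 0" and "i < length bs"
  shows "x i = 0"
proof -
  have dis: "distinct bs" and ind: "independent (set bs)"
    using assms(1) by (auto simp: lattice_basis_def)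
  have bij: "bij_betw ((!) bs) {..<length bs} (set bs)"
    using dis by (rule bij_betw_nth) auto
  \<comment> \<open>Independence speaks of coefficients indexed by vectors, so the coefficients are
    moved from positions to entries of \<open>bs\<close>, which are distinct.\<close>
  define u where "u = (\<lambda>b. x (the_inv_into {..<length bs} ((!) bs) b))"
  have u: "u (bs ! j) = x j" if "j < length bs" for j
    using bij that by (simp add: u_def the_inv_into_f_f bij_betw_def)
  have "(\<Sum>b\<in>set bs. u b *\<^sub>R b) = (\<Sum>i<length bs. u (bs ! i) *\<^sub>R (bs ! i))"
    by (rule sum.reindex_bij_betw[OF bij, symmetric])
  also have "\<dots> = 0"
    using assms(2) by (simp add: u)
  finally have "u (bs ! i) = 0"
    using independentD[OF ind, of "set bs" u "bs ! i"] assms(3) by simp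
  then show ?thesis
    using u assms(3) by simp
qed

lemma lattice_basis_sum_mem_iff:
  assumes "lattice_basis L bs"
  shows "(\<Sum>i<length bs. x i *\<^sub>R (bs ! i)) \<in> L \<longleftrightarrow> (\<forall>i<length bs. x i \<in> \<int>)"
proof
  assume "(\<Sum>i<length bs. x i *\<^sub>R (bs ! i)) \<in> L"
  then obtain c :: "nat \<Rightarrow> int"
    where "(\<Sum>i<length bs. x i *\<^sub>R (bs ! i)) = (\<Sum>i<length bs. of_int (c i) *\<^sub>R (bs ! i))"
    using assms by (auto simp: lattice_basis_def)
  then have "(\<Sum>i<length bs. (x i - of_int (c i)) *\<^sub>R (bs ! i)) = 0"
    by (simp add: algebra_simps sum_subtractf)
  then have "x i - of_int (c i) = 0" if "i < length bs" for i
    using lattice_basis_sum_eq_0[OF assms, of "\<lambda>i. x i - of_int (c i)"] that by simp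
  then show "\<forall>i<length bs. x i \<in> \<int>"
    by (metis Ints_of_int eq_iff_diff_eq_0)
next
  assume "\<forall>i<length bs. x i \<in> \<int>"
  then have "\<forall>i<length bs. x i = of_int \<lfloor>x i\<rfloor>"
    by (simp add: of_int_floor_cancel)
  then have "(\<Sum>i<length bs. x i *\<^sub>R (bs ! i)) = (\<Sum>i<length bs. of_int \<lfloor>x i\<rfloor> *\<^sub>R (bs ! i))"
    by (intro sum.cong refl) (metis lessThan_iff)
  also have "\<dots> \<in> L"
    using assms by (auto simp: lattice_basis_def intro: exI[of _ "\<lambda>i. \<lfloor>x i\<rfloor>"])
  finally show "(\<Sum>i<length bs. x i *\<^sub>R (bs ! i)) \<in> L" .
qed

lemma lattice_basis_nth_mem:
  assumes "lattice_basis L bs" and "i < length bs"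
  shows "bs ! i \<in> L"
proof -
  have "(\<Sum>j<length bs. (if j = i then 1 else 0) *\<^sub>R (bs ! j)) = bs ! i"
    using assms(2) by (simp add: if_distrib[of "\<lambda>c. c *\<^sub>R _"] cong: if_cong)
  then show ?thesis
    using lattice_basis_sum_mem_iff[OF assms(1), of "\<lambda>j. if j = i then 1 else 0"] by auto
qed

text \<open>A kernel vector of the Gram matrix is the coordinate vector of some \<open>v\<close>
  orthogonal to every basis vector, hence to \<open>L\<close>. Nondegeneracy thus becomes a
  statement about the form that does not mention the basis.\<close>

lemma det_gram_matrix_nonzero:
  assumes bs: "lattice_basis L bs" and B: "bilinear B"
    and ker: "\<And>v. v \<in> span L \<Longrightarrow> (\<And>w. w \<in> L \<Longrightarrow> B w v = 0) \<Longrightarrow> v = 0"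
  shows "Determinant.det (gram_matrix B bs) \<noteq> 0"
proof
  let ?n = "length bs"
  assume "Determinant.det (gram_matrix B bs) = 0"
  moreover have A: "gram_matrix B bs \<in> carrier_mat ?n ?n"
    by (simp add: gram_matrix_def)
  ultimately obtain x where x: "x \<in> carrier_vec ?n" "x \<noteq> 0\<^sub>v ?n"
      and Ax: "gram_matrix B bs *\<^sub>v x = 0\<^sub>v ?n"
    using det_0_iff_vec_prod_zero by blast
  define v where "v = (\<Sum>j<?n. vec_index x j *\<^sub>R (bs ! j))"
  have lin: "linear (B w)" for w
    using B by (simp add: bilinear_def)
  have Bv: "B (bs ! i) v = 0" if "i < ?n" for i
  proof -
    have "B (bs ! i) v = (\<Sum>j<?n. vec_index x j * B (bs ! i) (bs ! j))"
      by (simp add: v_def linear_sum[OF lin] linear_scale[OF lin])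
    also have "\<dots> = vec_index (gram_matrix B bs *\<^sub>v x) i"
      using that x by (auto simp: gram_matrix_def scalar_prod_def lessThan_atLeast0 mult.commute
          intro!: sum.cong)
    finally show ?thesis
      using Ax that by simp
  qed
  have "v = 0"
  proof (rule ker)
    show "v \<in> span L"
      unfolding v_def
      by (intro span_sum span_scale span_base) (auto intro: lattice_basis_nth_mem[OF bs])
    fix w assume "w \<in> L"
    then obtain c :: "nat \<Rightarrow> int" where w: "w = (\<Sum>i<?n. of_int (c i) *\<^sub>R (bs ! i))"
      using bs by (auto simp: lattice_basis_def)
    have lin': "linear (\<lambda>u. B u v)"
      using B by (simp add: bilinear_def)
    show "B w v = 0"
      by (simp add: w linear_sum[OF lin'] linear_scale[OF lin'] Bv)
  qed
  then have "vec_index x i = 0" if "i < ?n" for i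
    using lattice_basis_sum_eq_0[OF bs, of "vec_index x"] that by (simp add: v_def)
  then have "x = 0\<^sub>v ?n"
    using x(1) by (intro eq_vecI) auto
  then show False
    using x(2) by simp
qed

section \<open>The discriminant group as cosets of the lattice in its dual\<close>

locale even_lattice =
  fixes L :: "'v::real_vector set" and B :: "'v \<Rightarrow> 'v \<Rightarrow> real"
  assumes lattice: "is_lattice L B" and even: "even_form L B"
begin

lemma bilin: "bilinear B"
  using lattice by (simp add: is_lattice_def)

lemma sym: "B x y = B y x"
  using lattice by (simp add: is_lattice_def)

lemmas form_simps =
  bilinear_ladd[OF bilin] bilinear_radd[OF bilin] bilinear_lsub[OF bilin] bilinear_rsub[OF bilin]
  bilinear_lmul[OF bilin] bilinear_rmul[OF bilin] bilinear_lneg[OF bilin] bilinear_rneg[OF bilin]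
  bilinear_lzero[OF bilin] bilinear_rzero[OF bilin]

lemma form_int: "x \<in> L \<Longrightarrow> y \<in> L \<Longrightarrow> B x y \<in> \<int>"
  using even by (simp add: even_form_def)

lemma half_norm_int: "x \<in> L \<Longrightarrow> B x x / 2 \<in> \<int>"
  using even by (auto simp: even_form_def)

lemma add_mem:
  assumes "x \<in> L" and "y \<in> L"
  shows "x + y \<in> L"
proof -
  obtain bs where bs: "lattice_basis L bs"
    using lattice by (auto simp: is_lattice_def)
  obtain c d :: "nat \<Rightarrow> int" where "x = (\<Sum>i<length bs. of_int (c i) *\<^sub>R (bs ! i))"
    and "y = (\<Sum>i<length bs. of_int (d i) *\<^sub>R (bs ! i))"
    using assms bs by (auto simp: lattice_basis_def)
  then have "x + y = (\<Sum>i<length bs. of_int (c i + d i) *\<^sub>R (bs ! i))"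
    by (simp add: sum.distrib scaleR_add_left)
  then show ?thesis
    using lattice_basis_sum_mem_iff[OF bs, of "\<lambda>i. of_int (c i + d i)"] by simp
qed

lemma scale_mem:
  assumes "x \<in> L"
  shows "of_int k *\<^sub>R x \<in> L"
proof -
  obtain bs where bs: "lattice_basis L bs"
    using lattice by (auto simp: is_lattice_def)
  obtain c :: "nat \<Rightarrow> int" where "x = (\<Sum>i<length bs. of_int (c i) *\<^sub>R (bs ! i))"
    using assms bs by (auto simp: lattice_basis_def)
  then have "of_int k *\<^sub>R x = (\<Sum>i<length bs. of_int (k * c i) *\<^sub>R (bs ! i))"
    by (simp add: scaleR_sum_right)
  then show ?thesis
    using lattice_basis_sum_mem_iff[OF bs, of "\<lambda>i. of_int (k * c i)"] by simp
qed

lemma uminus_mem: "x \<in> L \<Longrightarrow> - x \<in> L"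
  using scale_mem[of x "-1"] by simp

lemma diff_mem: "x \<in> L \<Longrightarrow> y \<in> L \<Longrightarrow> x - y \<in> L"
  using add_mem[of x "- y"] uminus_mem by simp

lemma zero_mem: "0 \<in> L"
proof -
  obtain bs where bs: "lattice_basis L bs"
    using lattice by (auto simp: is_lattice_def)
  then show ?thesis
    using lattice_basis_sum_mem_iff[OF bs, of "\<lambda>_. 0"] by simp
qed

abbreviation dual :: "'v set" where
  "dual \<equiv> dual_lattice L B"

lemma mem_dual: "x \<in> L \<Longrightarrow> x \<in> dual"
  by (auto simp: dual_lattice_def intro: span_base form_int)

lemma dual_form_int: "v \<in> dual \<Longrightarrow> w \<in> L \<Longrightarrow> B v w \<in> \<int>"
  by (simp add: dual_lattice_def)

lemma dual_add: "v \<in> dual \<Longrightarrow> w \<in> dual \<Longrightarrow> v + w \<in> dual"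
  by (auto simp: dual_lattice_def form_simps intro: span_add)

lemma dual_diff: "v \<in> dual \<Longrightarrow> w \<in> dual \<Longrightarrow> v - w \<in> dual"
  by (auto simp: dual_lattice_def form_simps intro: span_diff)

lemma dual_scale: "v \<in> dual \<Longrightarrow> of_int k *\<^sub>R v \<in> dual"
  by (auto simp: dual_lattice_def form_simps intro: span_scale)

lemmas dual_closed = dual_add dual_diff dual_scale mem_dual

text \<open>With \<open>w = v + l\<close> the difference is \<open>B v l + B l l / 2\<close>; the
  first term is integral by duality, the second because the lattice is even.\<close>

lemma half_norm_cong:
  assumes "v \<in> dual" and "w - v \<in> L"
  shows "B w w / 2 - B v v / 2 \<in> \<int>"
proof -
  define l where "l = w - v"
  have w: "w = v + l"
    by (simp add: l_def)
  have "B w w / 2 - B v v / 2 = B v l + B l l / 2"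
    by (simp add: w form_simps sym[of l v] field_simps)
  then show ?thesis
    using dual_form_int half_norm_int assms by (simp add: l_def)
qed

abbreviation dual_group :: "'v monoid" where
  "dual_group \<equiv> \<lparr>carrier = dual, monoid.mult = (+), one = 0\<rparr>"

lemma dual_comm_group: "comm_group dual_group"
proof (rule comm_groupI)
  fix x assume "x \<in> carrier dual_group"
  then have "- x \<in> dual"
    using dual_scale[of x "-1"] by simp
  then show "\<exists>y\<in>carrier dual_group. y \<otimes>\<^bsub>dual_group\<^esub> x = \<one>\<^bsub>dual_group\<^esub>"
    by (intro bexI[of _ "-x"]) auto
qed (auto simp: dual_add mem_dual zero_mem add.assoc add.commute)

lemma normal_dual_group: "normal L dual_group"
proof -
  interpret D: comm_group dual_group
    by (rule dual_comm_group)
  have "inv\<^bsub>dual_group\<^esub> x = - x" if "x \<in> L" for x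
    by (rule D.inv_equality) (use that in \<open>auto simp: mem_dual uminus_mem\<close>)
  then have "subgroup L dual_group"
    using zero_mem by (intro D.subgroupI) (auto simp: mem_dual uminus_mem add_mem)
  then show ?thesis
    by (rule D.normal_iff_subgroup[THEN iffD2])
qed

text \<open>This is the translate v + L, written as a right coset so that the library results on
  factor groups apply.\<close>

definition coset :: "'v \<Rightarrow> 'v set" where
  "coset v = L #>\<^bsub>dual_group\<^esub> v"

lemma mem_coset_iff: "w \<in> coset v \<longleftrightarrow> w - v \<in> L"
  by (force simp: coset_def r_coset_def)

lemma coset_eq_iff: "coset v = coset w \<longleftrightarrow> v - w \<in> L"
proof
  assume "coset v = coset w"
  moreover have "v \<in> coset v"
    by (simp add: mem_coset_iff zero_mem)
  ultimately show "v - w \<in> L"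
    by (simp add: mem_coset_iff)
next
  assume "v - w \<in> L"
  then have "u - v \<in> L \<longleftrightarrow> u - w \<in> L" for u
    using add_mem[of "u - v" "v - w"] diff_mem[of "u - w" "v - w"] by auto
  then show "coset v = coset w"
    by (auto simp: mem_coset_iff)
qed

lemma carrier_discriminant: "carrier (fst (discriminant_module L B)) = coset ` dual"
  by (simp add: discriminant_module_def carrier_FactGroup coset_def)

lemma coset_hom: "coset \<in> hom dual_group (fst (discriminant_module L B))"
  using normal.r_coset_hom_Mod[OF normal_dual_group]
  by (simp add: discriminant_module_def coset_def[abs_def])

lemma coset_add:
  "v \<in> dual \<Longrightarrow> w \<in> dual \<Longrightarrow>
    coset v \<otimes>\<^bsub>fst (discriminant_module L B)\<^esub> coset w = coset (v + w)"
  using hom_mult[OF coset_hom, of v w] by simp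

lemma discriminant_form_coset:
  assumes "v \<in> dual"
  shows "snd (discriminant_module L B) (coset v) = mod_one (B v v / 2)"
proof -
  have "mod_one (B w w / 2) = mod_one (B v v / 2)" if "w \<in> coset v" for w
    using half_norm_cong[OF assms] that by (simp add: mem_coset_iff mod_one_eq_iff)
  moreover have "v \<in> coset v"
    by (simp add: mem_coset_iff zero_mem)
  ultimately have "(\<Union>w\<in>coset v. mod_one (B w w / 2)) = mod_one (B v v / 2)"
    by blast
  then show ?thesis
    by (simp add: discriminant_module_def)
qed

end

section \<open>Isometries as pairs of generators\<close>

text \<open>The common shape of \<open>module_B\<close> and \<open>module_C\<close>, so that one
  translation into generators serves both.\<close>

definition quadratic_module_mod :: "nat \<Rightarrow> (int \<Rightarrow> int \<Rightarrow> int) \<Rightarrow> (int \<times> int) quadratic_module" where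
  "quadratic_module_mod q \<phi> = (integer_mod_group q \<times>\<times> integer_mod_group q,
     \<lambda>(x, y). mod_one (of_int (\<phi> x y) / of_nat q))"

text \<open>The last clause prescribes the norm of every integral combination, instead of the two
  norms and the inner product. In this form it makes sense for an arbitrary function
  \<open>\<phi>\<close> and needs no polarization.\<close>

definition discriminant_generators ::
  "'v::real_vector set \<Rightarrow> ('v \<Rightarrow> 'v \<Rightarrow> real) \<Rightarrow> nat \<Rightarrow> (int \<Rightarrow> int \<Rightarrow> int) \<Rightarrow> 'v \<Rightarrow> 'v \<Rightarrow> bool" where
  "discriminant_generators L B q \<phi> p p' \<longleftrightarrow>
     p \<in> dual_lattice L B \<and> p' \<in> dual_lattice L B \<and>
     (\<forall>v\<in>dual_lattice L B. \<exists>a b :: int. v - (of_int a *\<^sub>R p + of_int b *\<^sub>R p') \<in> L) \<and>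
     (\<forall>a b :: int. of_int a *\<^sub>R p + of_int b *\<^sub>R p' \<in> L \<longleftrightarrow> int q dvd a \<and> int q dvd b) \<and>
     (\<forall>(a::int) (b::int) v. v = of_int a *\<^sub>R p + of_int b *\<^sub>R p' \<longrightarrow>
        B v v / 2 - of_int (\<phi> a b) / of_nat q \<in> \<int>)"

context even_lattice
begin

text \<open>The explicit map runs from pairs of residues to cosets. It is shown to be an isomorphism
  in that direction, and the isometry asked for is its inverse.\<close>

lemma isometrically_isomorphic_if_generators:
  assumes q: "q > 0" and gen: "discriminant_generators L B q \<phi> p p'"
  shows "isometrically_isomorphic (discriminant_module L B) (quadratic_module_mod q \<phi>)"
proof -
  let ?D = "discriminant_module L B" and ?M = "quadratic_module_mod q \<phi>"
  define comb where "comb a b = of_int a *\<^sub>R p + of_int b *\<^sub>R p'" for a b :: int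
  have comb_dual: "comb a b \<in> dual" for a b
    using gen by (auto simp: comb_def discriminant_generators_def intro: dual_closed)
  have surj: "\<exists>a b. v - comb a b \<in> L" if "v \<in> dual" for v
    using gen that by (auto simp: comb_def discriminant_generators_def)
  have ker: "comb a b \<in> L \<longleftrightarrow> int q dvd a \<and> int q dvd b" for a b
    using gen by (auto simp: comb_def discriminant_generators_def)
  have form: "B (comb a b) (comb a b) / 2 - of_int (\<phi> a b) / of_nat q \<in> \<int>" for a b
    using gen by (auto simp: comb_def discriminant_generators_def)
  have comb_diff: "comb a b - comb a' b' = comb (a - a') (b - b')" for a b a' b'
    by (simp add: comb_def algebra_simps)
  have comb_add: "comb a b + comb a' b' = comb (a + a') (b + b')" for a b a' b'
    by (simp add: comb_def algebra_simps)
  define f where "f = (\<lambda>(a, b). coset (comb a b))"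
  \<comment> \<open>This equivalence gives compatibility with reduction modulo \<open>q\<close>,
    injectivity, and the reduced preimage needed for surjectivity.\<close>
  have f_eq: "coset (comb a b) = coset (comb a' b') \<longleftrightarrow> a mod q = a' mod q \<and> b mod q = b' mod q"
    for a b a' b'
    by (simp add: coset_eq_iff comb_diff ker mod_eq_dvd_iff)
  have M: "group (fst ?M)" and carr: "carrier (fst ?M) = {0..<int q} \<times> {0..<int q}"
    using q by (simp_all add: quadratic_module_mod_def DirProd_group carrier_integer_mod_group)
  have "f \<in> iso (fst ?M) (fst ?D)"
  proof (rule isoI)
    show "f \<in> hom (fst ?M) (fst ?D)"
    proof (rule homI)
      fix x y assume "x \<in> carrier (fst ?M)" "y \<in> carrier (fst ?M)"
      show "f (x \<otimes>\<^bsub>fst ?M\<^esub> y) = f x \<otimes>\<^bsub>fst ?D\<^esub> f y"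
        by (cases x; cases y)
          (simp add: f_def coset_add comb_dual comb_add f_eq quadratic_module_mod_def)
    qed (auto simp: f_def carrier_discriminant comb_dual)
    show "bij_betw f (carrier (fst ?M)) (carrier (fst ?D))"
    proof (rule bij_betw_imageI)
      show "inj_on f (carrier (fst ?M))"
        unfolding carr by (auto simp: inj_on_def f_def f_eq)
      show "f ` carrier (fst ?M) = carrier (fst ?D)"
      proof
        show "f ` carrier (fst ?M) \<subseteq> carrier (fst ?D)"
          by (auto simp: f_def carrier_discriminant comb_dual)
        show "carrier (fst ?D) \<subseteq> f ` carrier (fst ?M)"
        proof
          fix X assume "X \<in> carrier (fst ?D)"
          then obtain v where v: "v \<in> dual" "X = coset v"
            by (auto simp: carrier_discriminant)
          then obtain a b where "X = coset (comb a b)"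
            using surj coset_eq_iff by metis
          then have "X = f (a mod q, b mod q)"
            by (simp add: f_def f_eq)
          moreover have "(a mod q, b mod q) \<in> carrier (fst ?M)"
            unfolding carr using q by simp
          ultimately show "X \<in> f ` carrier (fst ?M)"
            by (rule image_eqI)
        qed
      qed
    qed
  qed
  then have inv: "inv_into (carrier (fst ?M)) f \<in> iso (fst ?D) (fst ?M)"
    and bij: "bij_betw f (carrier (fst ?M)) (carrier (fst ?D))"
    using group.iso_set_sym[OF M] by (auto simp: iso_def)
  have "snd ?M (inv_into (carrier (fst ?M)) f X) = snd ?D X" if "X \<in> carrier (fst ?D)" for X
  proof -
    obtain a b where ab: "(a, b) = inv_into (carrier (fst ?M)) f X"
      by (metis surj_pair)
    then have X: "X = f (a, b)"
      using bij that by (simp add: bij_betw_inv_into_right)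
    have "snd ?D X = mod_one (B (comb a b) (comb a b) / 2)"
      by (simp add: X f_def discriminant_form_coset comb_dual)
    also have "\<dots> = snd ?M (a, b)"
      using form[of a b] by (simp add: mod_one_eq_iff quadratic_module_mod_def)
    finally show ?thesis
      by (simp add: ab)
  qed
  then show ?thesis
    unfolding isometrically_isomorphic_def using inv by blast
qed

text \<open>The generators are preimages of the two unit vectors. The congruence on
  \<open>\<phi>\<close> is needed because the module evaluates \<open>\<phi>\<close> at reduced
  residues, whereas the norm clause concerns all integers.\<close>

lemma generators_if_isometrically_isomorphic:
  assumes q: "q > 0"
    and \<phi>: "\<And>a b. [\<phi> (a mod q) (b mod q) = \<phi> a b] (mod q)"
    and iso: "isometrically_isomorphic (discriminant_module L B) (quadratic_module_mod q \<phi>)"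
  obtains p p' where "discriminant_generators L B q \<phi> p p'"
proof -
  let ?D = "discriminant_module L B" and ?M = "quadratic_module_mod q \<phi>"
  obtain f where f: "f \<in> iso (fst ?D) (fst ?M)"
    and form: "\<And>X. X \<in> carrier (fst ?D) \<Longrightarrow> snd ?M (f X) = snd ?D X"
    using iso by (auto simp: isometrically_isomorphic_def)
  define g where "g v = f (coset v)" for v
  have coset_carrier: "coset v \<in> carrier (fst ?D)" if "v \<in> dual" for v
    using that by (simp add: carrier_discriminant)
  have inj: "inj_on f (carrier (fst ?D))" and surj: "f ` carrier (fst ?D) = carrier (fst ?M)"
    using f by (auto simp: iso_def bij_betw_def)
  have carr: "carrier (fst ?M) = {0..<int q} \<times> {0..<int q}"
    using q by (simp add: quadratic_module_mod_def carrier_integer_mod_group)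
  have g_add: "g (v + w) = ((fst (g v) + fst (g w)) mod q, (snd (g v) + snd (g w)) mod q)"
    if "v \<in> dual" "w \<in> dual" for v w
  proof -
    have "g (v + w) = g v \<otimes>\<^bsub>fst ?M\<^esub> g w"
      using f that coset_carrier
      by (simp add: g_def coset_add[symmetric] iso_def hom_mult)
    then show ?thesis
      by (simp add: quadratic_module_mod_def mult_DirProd')
  qed
  have g_carr: "g v \<in> {0..<int q} \<times> {0..<int q}" if "v \<in> dual" for v
    using surj coset_carrier[OF that] carr unfolding g_def by blast
  have g_eq: "g v = g w \<longleftrightarrow> v - w \<in> L" if "v \<in> dual" "w \<in> dual" for v w
    using inj coset_carrier that by (simp add: g_def inj_on_eq_iff coset_eq_iff)
  have g_surj: "\<exists>v\<in>dual. g v = (a, b)" if "a \<in> {0..<int q}" "b \<in> {0..<int q}" for a b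
  proof -
    have "(a, b) \<in> f ` coset ` dual"
      using surj carr that by (simp add: carrier_discriminant)
    then show ?thesis
      by (auto simp: g_def image_iff)
  qed
  have g_scale: "g (of_int a *\<^sub>R v) = (a * fst (g v) mod q, a * snd (g v) mod q)"
    if v: "v \<in> dual" for a v
  proof -
    have g0: "g 0 = (0, 0)"
    proof -
      have "g 0 = ((fst (g 0) + fst (g 0)) mod q, (snd (g 0) + snd (g 0)) mod q)"
        using g_add[of 0 0] by (simp add: mem_dual zero_mem)
      moreover have "g 0 \<in> {0..<int q} \<times> {0..<int q}"
        by (simp add: g_carr mem_dual zero_mem)
      moreover have "x = 0" if "x = (x + x) mod int q" "0 \<le> x" "x < int q" for x :: int
      proof -
        have "(x + x) mod int q = x mod int q"
          using that by simp
        then have "int q dvd x"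
          by (simp add: mod_eq_dvd_iff)
        then show ?thesis
          using that zdvd_imp_le[of "int q" x] by fastforce
      qed
      ultimately show ?thesis
        by (metis (no_types, lifting) SigmaE atLeastLessThan_iff fst_conv snd_conv)
    qed
    have nat: "g (of_int (int n) *\<^sub>R w) = (int n * fst (g w) mod q, int n * snd (g w) mod q)"
      if w: "w \<in> dual" for n w
    proof (induction n)
      case (Suc n)
      have "of_int (int (Suc n)) *\<^sub>R w = of_int (int n) *\<^sub>R w + w"
        by (simp add: algebra_simps)
      then show ?case
        using Suc g_add[OF dual_scale[OF w, of "int n"] w]
        by (simp add: algebra_simps mod_simps)
    qed (simp add: g0)
    \<comment> \<open>The induction covers only natural multipliers. A general one is split by
      division with remainder: the remainder is natural, and the multiple of \<open>q\<close> is
      sent to zero, so inverses in the group never occur.\<close>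
    have "real_of_int (a mod q) + of_int (int q) * of_int (a div q) = of_int a"
      by (metis mod_mult_div_eq of_int_add of_int_mult)
    then have split: "of_int a *\<^sub>R v =
        of_int (a mod q) *\<^sub>R v + of_int (int q) *\<^sub>R (of_int (a div q) *\<^sub>R v)"
      by (metis scaleR_add_left scaleR_scaleR)
    have "g (of_int (a mod q) *\<^sub>R v) = (a * fst (g v) mod q, a * snd (g v) mod q)"
      using nat[OF v, of "nat (a mod q)"] q by (simp add: mod_simps)
    then show ?thesis
      unfolding split g_add[OF dual_scale[OF v] dual_scale[OF dual_scale[OF v]]]
        nat[OF dual_scale[OF v], of q "a div q"] by simp
  qed
  \<comment> \<open>The residue is written \<open>1 mod int q\<close> because for
    \<open>q = 1\<close> it is 0.\<close>
  have one: "1 mod int q \<in> {0..<int q}" "0 \<in> {0..<int q}"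
    using q by auto
  obtain p p' where p: "p \<in> dual" "g p = (1 mod int q, 0)" and p': "p' \<in> dual" "g p' = (0, 1 mod int q)"
    using g_surj[OF one] g_surj[OF one(2) one(1)] by blast
  define comb where "comb a b = of_int a *\<^sub>R p + of_int b *\<^sub>R p'" for a b :: int
  have comb_dual: "comb a b \<in> dual" for a b
    unfolding comb_def by (intro dual_closed p p')
  have g_comb: "g (comb a b) = (a mod q, b mod q)" for a b
    unfolding comb_def using p p'
    by (simp add: g_add dual_scale g_scale mod_simps)
  have "\<exists>a b. v - comb a b \<in> L" if "v \<in> dual" for v
  proof -
    obtain a b where "g v = (a, b)" "a \<in> {0..<int q}" "b \<in> {0..<int q}"
      using g_carr[OF \<open>v \<in> dual\<close>] by auto
    then have "g v = g (comb a b)"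
      by (simp add: g_comb)
    then show ?thesis
      using g_eq comb_dual \<open>v \<in> dual\<close> by blast
  qed
  moreover have "comb a b \<in> L \<longleftrightarrow> int q dvd a \<and> int q dvd b" for a b
  proof -
    have "comb a b \<in> L \<longleftrightarrow> g (comb a b) = g (comb 0 0)"
      unfolding g_eq[OF comb_dual comb_dual] by (simp add: comb_def)
    then show ?thesis
      by (simp add: g_comb dvd_eq_mod_eq_0)
  qed
  moreover have "B (comb a b) (comb a b) / 2 - of_int (\<phi> a b) / of_nat q \<in> \<int>" for a b
  proof -
    have "mod_one (of_int (\<phi> (a mod q) (b mod q)) / of_nat q) = mod_one (B (comb a b) (comb a b) / 2)"
      using form[OF coset_carrier[OF comb_dual[of a b]]] g_comb[of a b]
      by (simp add: discriminant_form_coset comb_dual g_def quadratic_module_mod_def)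
    then have "of_int (\<phi> (a mod q) (b mod q)) / of_nat q - B (comb a b) (comb a b) / 2 \<in> \<int>"
      by (simp add: mod_one_eq_iff)
    moreover have "of_int (\<phi> (a mod q) (b mod q)) / of_nat q - of_int (\<phi> a b) / of_nat q \<in> (\<int> :: real set)"
    proof -
      obtain k where "\<phi> (a mod q) (b mod q) - \<phi> a b = int q * k"
        using \<phi>[of a b] by (auto simp: cong_iff_dvd_diff)
      then have "of_int (\<phi> (a mod q) (b mod q)) - of_int (\<phi> a b) = real q * of_int k"
        by (metis of_int_diff of_int_mult of_int_of_nat_eq)
      then show ?thesis
        using q by (simp flip: diff_divide_distrib)
    qed
    ultimately show ?thesis
      using Ints_diff by fastforce
  qed
  ultimately have "discriminant_generators L B q \<phi> p p'"
    unfolding discriminant_generators_def comb_def using p p' by blast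
  then show thesis
    by (rule that)
qed

end

section \<open>Lower bounds for the rank from the 2-torsion\<close>

lemma of_int_half_in_Ints_iff: "of_int k / (2::real) \<in> \<int> \<longleftrightarrow> even k"
  using of_int_div_of_int_in_Ints_iff[of k 2, where ?'a = real] by auto

lemma det_gram_matrix_2:
  "Determinant.det (gram_matrix B [b, b']) = B b b * B b' b' - B b b' * B b' b"
proof -
  let ?A = "gram_matrix B [b, b']"
  have A: "?A \<in> carrier_mat 2 2"
    by (simp add: gram_matrix_def numeral_2_eq_2)
  have *: "Determinant.det (mat_delete ?A 0 j) = vec_index (Matrix.row ?A 1) (1 - j)" if "j < 2" for j
  proof -
    have "mat_delete ?A 0 j \<in> carrier_mat 1 1"
      using mat_delete_carrier[OF A, of 0 j] by simp
    then show ?thesis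
      using A that by (subst det_single) (auto simp: mat_delete_def gram_matrix_def less_2_cases_iff)
  qed
  have "Determinant.det ?A = (\<Sum>j<2. ?A $$ (0, j) * cofactor ?A 0 j)"
    by (rule laplace_expansion_row[OF A]) simp
  also have "\<dots> = ?A $$ (0, 0) * vec_index (Matrix.row ?A 1) 1
      - ?A $$ (0, 1) * vec_index (Matrix.row ?A 1) 0"
    by (simp add: numeral_2_eq_2 cofactor_def *)
  finally show ?thesis
    by (simp add: gram_matrix_def)
qed

context even_lattice
begin

text \<open>The vectors are \<open>w = q p\<close> and \<open>w' = q p'\<close>. Their halves are
  multiples of \<open>p\<close> and \<open>p'\<close> by q/2 and represent a basis of the 2-torsion
  over the field with two elements. Pairings of \<open>p\<close> and \<open>p'\<close> with
  \<open>L\<close> are integral, so those of \<open>w\<close> and \<open>w'\<close> are divisible by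
  \<open>q\<close>; as \<open>q\<close> is even, \<open>w\<close> and \<open>w'\<close> lie in the
  radical modulo 2.\<close>

lemma generators_half:
  assumes q: "even q" "q > 0" and gen: "discriminant_generators L B q \<phi> p p'"
  obtains w w' where "w \<in> L" "w' \<in> L"
    and "\<And>u. u \<in> L \<Longrightarrow> \<exists>m::int. B w u = of_nat q * of_int m"
    and "\<And>u. u \<in> L \<Longrightarrow> \<exists>m::int. B w' u = of_nat q * of_int m"
    and "\<And>a b :: int. (of_int a / 2) *\<^sub>R w + (of_int b / 2) *\<^sub>R w' \<in> L \<longleftrightarrow> even a \<and> even b"
    and "\<And>v. v \<in> dual \<Longrightarrow> 2 *\<^sub>R v \<in> L \<Longrightarrow>
      \<exists>a b :: int. v - ((of_int a / 2) *\<^sub>R w + (of_int b / 2) *\<^sub>R w') \<in> L"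
proof -
  obtain h where h: "q = 2 * h"
    using q by auto
  have p: "p \<in> dual" "p' \<in> dual"
    and surj: "\<And>v. v \<in> dual \<Longrightarrow> \<exists>a b :: int. v - (of_int a *\<^sub>R p + of_int b *\<^sub>R p') \<in> L"
    and ker: "\<And>a b :: int. of_int a *\<^sub>R p + of_int b *\<^sub>R p' \<in> L \<longleftrightarrow> int q dvd a \<and> int q dvd b"
    using gen by (auto simp: discriminant_generators_def)
  define w w' where "w = of_nat q *\<^sub>R p" and "w' = of_nat q *\<^sub>R p'"
  have half: "(of_int a / 2) *\<^sub>R w + (of_int b / 2) *\<^sub>R w'
      = of_int (int h * a) *\<^sub>R p + of_int (int h * b) *\<^sub>R p'" for a b :: int
    by (simp add: w_def w'_def h mult.commute)
  show thesis
  proof (rule that[of w w'])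
    show "w \<in> L" "w' \<in> L"
      using ker[of q 0] ker[of 0 q] by (simp_all add: w_def w'_def)
    show "\<exists>m::int. B w u = of_nat q * of_int m" "\<exists>m::int. B w' u = of_nat q * of_int m"
      if "u \<in> L" for u
      using dual_form_int[OF p(1) that] dual_form_int[OF p(2) that]
      by (auto simp: w_def w'_def form_simps elim!: Ints_cases)
    show "(of_int a / 2) *\<^sub>R w + (of_int b / 2) *\<^sub>R w' \<in> L \<longleftrightarrow> even a \<and> even b" for a b :: int
    proof -
      have "int q dvd int h * c \<longleftrightarrow> even c" for c
        using q by (simp add: h mult.commute[of 2])
      then show ?thesis
        unfolding half ker by simp
    qed
    fix v assume v: "v \<in> dual" "2 *\<^sub>R v \<in> L"
    obtain a b :: int where ab: "v - (of_int a *\<^sub>R p + of_int b *\<^sub>R p') \<in> L"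
      using surj v(1) by blast
    have "of_int (2 * a) *\<^sub>R p + of_int (2 * b) *\<^sub>R p'
        = 2 *\<^sub>R v - of_int 2 *\<^sub>R (v - (of_int a *\<^sub>R p + of_int b *\<^sub>R p'))"
      by (simp add: algebra_simps)
    then have "of_int (2 * a) *\<^sub>R p + of_int (2 * b) *\<^sub>R p' \<in> L"
      using diff_mem[OF v(2) scale_mem[OF ab, of 2]] by simp
    then have "int h dvd a" "int h dvd b"
      unfolding ker by (simp_all add: h)
    then obtain c d where "a = int h * c" "b = int h * d"
      by blast
    then show "\<exists>a b :: int. v - ((of_int a / 2) *\<^sub>R w + (of_int b / 2) *\<^sub>R w') \<in> L"
      using ab half by metis
  qed
qed

text \<open>The classes of \<open>w\<close> and \<open>w'\<close> in L/2L are independent over the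
  field with two elements, which a lattice of rank at most 1 cannot accommodate.\<close>

lemma rank_ge_2_if_generators:
  assumes bs: "lattice_basis L bs"
    and q: "even q" "q > 0" and gen: "discriminant_generators L B q \<phi> p p'"
  shows "length bs \<ge> 2"
proof (rule ccontr)
  assume "\<not> ?thesis"
  then consider "bs = []" | b where "bs = [b]"
    \<comment> \<open>The rule serves only as the case split into the empty list, a singleton and at
      least two entries.\<close>
    by (cases bs rule: remdups_adj.cases) auto
  then show False
  proof cases
    case 1
    then have L: "L = {0}"
      using bs by (simp add: lattice_basis_def)
    from generators_half[OF q gen] obtain w w' where "w \<in> L" "w' \<in> L"
      and "\<And>a b :: int. (of_int a / 2) *\<^sub>R w + (of_int b / 2) *\<^sub>R w' \<in> L \<longleftrightarrow> even a \<and> even b"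
      by metis
    from this(1,2) this(3)[of 1 0] show False
      by (simp add: L)
  next
    case 2
    have mem: "x *\<^sub>R b \<in> L \<longleftrightarrow> x \<in> \<int>" for x
      using lattice_basis_sum_mem_iff[OF bs, of "\<lambda>_. x"] 2 by simp
    have coord: "\<exists>c::int. u = of_int c *\<^sub>R b" if "u \<in> L" for u
      using bs that 2 by (auto simp: lattice_basis_def)
    from generators_half[OF q gen] obtain w w' where w: "w \<in> L" "w' \<in> L"
      and half: "\<And>a b :: int. (of_int a / 2) *\<^sub>R w + (of_int b / 2) *\<^sub>R w' \<in> L \<longleftrightarrow> even a \<and> even b"
      by metis
    obtain c d :: int where cd: "w = of_int c *\<^sub>R b" "w' = of_int d *\<^sub>R b"
      using coord w by metis
    have "(of_int i / 2) *\<^sub>R w + (of_int j / 2) *\<^sub>R w' = (of_int (i * c + j * d) / 2) *\<^sub>R b" for i j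
      by (simp add: cd add_divide_distrib scaleR_add_left)
    then have "even (i * c + j * d) \<longleftrightarrow> even i \<and> even j" for i j
      using half[of i j] mem of_int_half_in_Ints_iff by metis
    \<comment> \<open>These instances make \<open>c\<close>, \<open>d\<close> and
      \<open>c + d\<close> all odd.\<close>
    from this[of 1 0] this[of 0 1] this[of 1 1] show False
      by simp
  qed
qed

text \<open>Modulo 2 the diagonal of the Gram matrix vanishes, and two independent kernel vectors
  force the off-diagonal entries to vanish too. Then half of each basis vector is dual, so the
  2-torsion has dimension 3, although two elements generate it.\<close>

lemma rank_ne_3_if_generators:
  assumes bs: "lattice_basis L bs"
    and q: "even q" "q > 0" and gen: "discriminant_generators L B q \<phi> p p'"
  shows "length bs \<noteq> 3"
proof
  assume "length bs = 3"
  then obtain b1 b2 b3 where bs_eq: "bs = [b1, b2, b3]"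
    by (auto simp: numeral_3_eq_3 length_Suc_conv)
  have mem: "x *\<^sub>R b1 + y *\<^sub>R b2 + z *\<^sub>R b3 \<in> L \<longleftrightarrow> x \<in> \<int> \<and> y \<in> \<int> \<and> z \<in> \<int>" for x y z
  proof -
    have "(\<forall>i<3. [x, y, z] ! i \<in> \<int>) \<longleftrightarrow> x \<in> \<int> \<and> y \<in> \<int> \<and> z \<in> \<int>"
      by (auto simp: numeral_3_eq_3 less_Suc_eq)
    then show ?thesis
      using lattice_basis_sum_mem_iff[OF bs, of "\<lambda>i. [x, y, z] ! i"]
      by (simp add: bs_eq numeral_3_eq_3 add.assoc)
  qed
  have coord: "\<exists>i j k :: int. u = of_int i *\<^sub>R b1 + of_int j *\<^sub>R b2 + of_int k *\<^sub>R b3" if "u \<in> L" for u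
  proof -
    obtain c :: "nat \<Rightarrow> int" where "u = (\<Sum>i<length bs. of_int (c i) *\<^sub>R (bs ! i))"
      using bs \<open>u \<in> L\<close> by (auto simp: lattice_basis_def)
    then have "u = of_int (c 0) *\<^sub>R b1 + of_int (c 1) *\<^sub>R b2 + of_int (c 2) *\<^sub>R b3"
      by (simp add: bs_eq numeral_2_eq_2)
    then show ?thesis
      by blast
  qed
  have b: "b1 \<in> L" "b2 \<in> L" "b3 \<in> L"
    using mem[of 1 0 0] mem[of 0 1 0] mem[of 0 0 1] by simp_all
  from generators_half[OF q gen] obtain w w' where w: "w \<in> L" "w' \<in> L"
    and wB: "\<And>u. u \<in> L \<Longrightarrow> \<exists>m::int. B w u = of_nat q * of_int m"
    and w'B: "\<And>u. u \<in> L \<Longrightarrow> \<exists>m::int. B w' u = of_nat q * of_int m"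
    and half: "\<And>a b :: int. (of_int a / 2) *\<^sub>R w + (of_int b / 2) *\<^sub>R w' \<in> L \<longleftrightarrow> even a \<and> even b"
    and tors: "\<And>v. v \<in> dual \<Longrightarrow> 2 *\<^sub>R v \<in> L \<Longrightarrow>
      \<exists>a b :: int. v - ((of_int a / 2) *\<^sub>R w + (of_int b / 2) *\<^sub>R w') \<in> L"
    by metis
  obtain c1 c2 c3 d1 d2 d3 :: int
    where wc: "w = of_int c1 *\<^sub>R b1 + of_int c2 *\<^sub>R b2 + of_int c3 *\<^sub>R b3"
      and wd: "w' = of_int d1 *\<^sub>R b1 + of_int d2 *\<^sub>R b2 + of_int d3 *\<^sub>R b3"
    using coord w by metis
  obtain \<alpha> \<beta> \<gamma> k1 k2 k3 :: int
    where off: "B b1 b2 = of_int \<alpha>" "B b1 b3 = of_int \<beta>" "B b2 b3 = of_int \<gamma>"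
      and diag: "B b1 b1 = 2 * of_int k1" "B b2 b2 = 2 * of_int k2" "B b3 b3 = 2 * of_int k3"
    using form_int b even unfolding even_form_def by (metis Ints_cases)
  note gram = off diag sym[of b2 b1] sym[of b3 b1] sym[of b3 b2]
  have even_if: "even k" if "of_int k = real q * of_int m" for k m :: int
  proof -
    have "k = int q * m"
      using that by (metis of_int_eq_iff of_int_mult of_int_of_nat_eq)
    then show ?thesis
      using q(1) by simp
  qed
  have rad: "even (\<alpha> * y + \<beta> * z)" "even (\<alpha> * x + \<gamma> * z)" "even (\<beta> * x + \<gamma> * y)"
    if u: "u = of_int x *\<^sub>R b1 + of_int y *\<^sub>R b2 + of_int z *\<^sub>R b3"
      and uB: "\<And>v. v \<in> L \<Longrightarrow> \<exists>m::int. B u v = of_nat q * of_int m" for u x y z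
  proof -
    have "B u b1 = of_int (2 * (k1 * x) + (\<alpha> * y + \<beta> * z))"
      "B u b2 = of_int (2 * (k2 * y) + (\<alpha> * x + \<gamma> * z))"
      "B u b3 = of_int (2 * (k3 * z) + (\<beta> * x + \<gamma> * y))"
      by (simp_all add: u form_simps gram algebra_simps)
    then have "even (2 * (k1 * x) + (\<alpha> * y + \<beta> * z))" "even (2 * (k2 * y) + (\<alpha> * x + \<gamma> * z))"
      "even (2 * (k3 * z) + (\<beta> * x + \<gamma> * y))"
      using uB[OF b(1)] uB[OF b(2)] uB[OF b(3)] even_if by metis+
    then show "even (\<alpha> * y + \<beta> * z)" "even (\<alpha> * x + \<gamma> * z)" "even (\<beta> * x + \<gamma> * y)"
      by simp_all
  qed
  have comb: "(of_int i / 2) *\<^sub>R w + (of_int j / 2) *\<^sub>R w' = (of_int (i * c1 + j * d1) / 2) *\<^sub>R b1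
      + (of_int (i * c2 + j * d2) / 2) *\<^sub>R b2 + (of_int (i * c3 + j * d3) / 2) *\<^sub>R b3" for i j
    by (simp add: wc wd add_divide_distrib algebra_simps)
  have indep: "even (i * c1 + j * d1) \<and> even (i * c2 + j * d2) \<and> even (i * c3 + j * d3)
      \<longleftrightarrow> even i \<and> even j" for i j
    using half[of i j] unfolding comb mem of_int_half_in_Ints_iff .
  have "\<not> (even c1 \<and> even c2 \<and> even c3)" "\<not> (even d1 \<and> even d2 \<and> even d3)"
    "\<not> (even (c1 + d1) \<and> even (c2 + d2) \<and> even (c3 + d3))"
    using indep[of 1 0] indep[of 0 1] indep[of 1 1] by simp_all
  \<comment> \<open>If some entry were odd, the kernel modulo 2 would consist of 0 and (\<gamma>,
    \<beta>, \<alpha>), too small for the three distinct nonzero vectors c, d and c + d.\<close>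
  then have ev: "even \<alpha>" "even \<beta>" "even \<gamma>"
    using rad[OF wc wB] rad[OF wd w'B] by (auto simp: even_add even_mult_iff)
  have half_dual: "(1 / 2) *\<^sub>R b \<in> dual" if b': "b \<in> {b1, b2, b3}" for b
    unfolding dual_lattice_def
  proof safe
    show "(1 / 2) *\<^sub>R b \<in> span L"
      using b b' by (auto intro: span_scale span_base)
    fix u assume "u \<in> L"
    then obtain i j k :: int where u: "u = of_int i *\<^sub>R b1 + of_int j *\<^sub>R b2 + of_int k *\<^sub>R b3"
      using coord by blast
    obtain \<alpha>' \<beta>' \<gamma>' where "\<alpha> = 2 * \<alpha>'" "\<beta> = 2 * \<beta>'" "\<gamma> = 2 * \<gamma>'"
      using ev by blast
    then show "B ((1 / 2) *\<^sub>R b) u \<in> \<int>"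
      using b' by (auto simp: u form_simps gram)
  qed
  have span: "\<exists>a a'. even (x - (a * c1 + a' * d1)) \<and> even (y - (a * c2 + a' * d2))
      \<and> even (z - (a * c3 + a' * d3))"
    if bxyz: "b = of_int x *\<^sub>R b1 + of_int y *\<^sub>R b2 + of_int z *\<^sub>R b3" and b': "b \<in> {b1, b2, b3}" for b x y z
  proof -
    have "2 *\<^sub>R ((1 / 2) *\<^sub>R b) \<in> L"
      using b b' by auto
    then obtain a a' where "(1 / 2) *\<^sub>R b - ((of_int a / 2) *\<^sub>R w + (of_int a' / 2) *\<^sub>R w') \<in> L"
      using tors half_dual[OF b'] by blast
    moreover have "(1 / 2) *\<^sub>R b - ((of_int a / 2) *\<^sub>R w + (of_int a' / 2) *\<^sub>R w')
      = (of_int (x - (a * c1 + a' * d1)) / 2) *\<^sub>R b1 + (of_int (y - (a * c2 + a' * d2)) / 2) *\<^sub>R b2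
        + (of_int (z - (a * c3 + a' * d3)) / 2) *\<^sub>R b3"
      unfolding comb bxyz by (simp add: diff_divide_distrib algebra_simps)
    ultimately show ?thesis
      using mem of_int_half_in_Ints_iff by metis
  qed
  \<comment> \<open>Modulo 2 all three unit vectors would be combinations of the two vectors c and
    d.\<close>
  have "\<exists>a a'. even (1 - (a * c1 + a' * d1)) \<and> even (0 - (a * c2 + a' * d2))
      \<and> even (0 - (a * c3 + a' * d3))"
    by (rule span[of b1]) auto
  moreover have "\<exists>a a'. even (0 - (a * c1 + a' * d1)) \<and> even (1 - (a * c2 + a' * d2))
      \<and> even (0 - (a * c3 + a' * d3))"
    by (rule span[of b2]) auto
  moreover have "\<exists>a a'. even (0 - (a * c1 + a' * d1)) \<and> even (0 - (a * c2 + a' * d2))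
      \<and> even (1 - (a * c3 + a' * d3))"
    by (rule span[of b3]) auto
  ultimately show False
    by (auto simp: even_add even_diff even_mult_iff)
qed

text \<open>The discriminant group is annihilated by \<open>q\<close>; in rank 2 this takes the
  place of counting its elements.\<close>

lemma generators_scale_mem:
  assumes gen: "discriminant_generators L B q \<phi> p p'" and v: "v \<in> dual"
  shows "of_nat q *\<^sub>R v \<in> L"
proof -
  obtain a b :: int where ab: "v - (of_int a *\<^sub>R p + of_int b *\<^sub>R p') \<in> L"
    using gen v by (auto simp: discriminant_generators_def)
  have "of_int (int q * a) *\<^sub>R p + of_int (int q * b) *\<^sub>R p' \<in> L"
    using gen unfolding discriminant_generators_def by (metis dvd_triv_left)
  moreover have "of_nat q *\<^sub>R v = of_int (int q) *\<^sub>R (v - (of_int a *\<^sub>R p + of_int b *\<^sub>R p'))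
      + (of_int (int q * a) *\<^sub>R p + of_int (int q * b) *\<^sub>R p')"
    by (simp add: algebra_simps)
  ultimately show ?thesis
    using add_mem scale_mem[OF ab] by metis
qed

text \<open>Scaling by \<open>q\<close> turns a class modulo 1 into an integer modulo
  \<open>q\<close>, whose parity is meaningful when \<open>q\<close> is even.\<close>

lemma generators_form_scaled:
  assumes q: "q > 0" and gen: "discriminant_generators L B q \<phi> p p'" and v: "v \<in> dual"
  obtains a b k :: int where "v - (of_int a *\<^sub>R p + of_int b *\<^sub>R p') \<in> L"
    and "of_nat q * (B v v / 2) = of_int (\<phi> a b + int q * k)"
proof -
  obtain a b :: int where ab: "v - (of_int a *\<^sub>R p + of_int b *\<^sub>R p') \<in> L"
    using gen v by (auto simp: discriminant_generators_def)
  define u where "u = of_int a *\<^sub>R p + of_int b *\<^sub>R p'"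
  have "u \<in> dual"
    using gen by (auto simp: u_def discriminant_generators_def intro: dual_closed)
  then have "B v v / 2 - B u u / 2 \<in> \<int>"
    using half_norm_cong ab by (simp add: u_def)
  moreover have "B u u / 2 - of_int (\<phi> a b) / of_nat q \<in> \<int>"
    using gen u_def by (auto simp: discriminant_generators_def)
  ultimately have "(B v v / 2 - B u u / 2) + (B u u / 2 - of_int (\<phi> a b) / of_nat q) \<in> \<int>"
    by (rule Ints_add)
  then obtain k where "B v v / 2 = of_int (\<phi> a b) / of_nat q + of_int k"
    by (auto elim!: Ints_cases simp: algebra_simps)
  then have "of_nat q * (B v v / 2) = of_int (\<phi> a b + int q * k)"
    using q by (simp add: field_simps)
  then show thesis
    using that ab by blast
qed

text \<open>The form a^2 + ab + b^2 is anisotropic modulo 2: it is even only when a and b are. An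
  even scaled half norm therefore makes the class of \<open>v\<close> twice another one, and q/2
  annihilates it.\<close>

lemma half_scale_mem_if_even_norm:
  assumes q: "even q" "q > 0"
    and gen: "discriminant_generators L B q (\<lambda>x y. x\<^sup>2 + x * y + y\<^sup>2) p p'"
    and v: "v \<in> dual" and norm: "of_nat q * (B v v / 2) = of_int m" "even m"
  shows "(of_nat q / 2) *\<^sub>R v \<in> L"
proof -
  obtain a b k :: int where ab: "v - (of_int a *\<^sub>R p + of_int b *\<^sub>R p') \<in> L"
    and "of_nat q * (B v v / 2) = of_int ((a\<^sup>2 + a * b + b\<^sup>2) + int q * k)"
    using generators_form_scaled[OF q(2) gen v] by blast
  then have "m = (a\<^sup>2 + a * b + b\<^sup>2) + int q * k"
    using norm(1) by (metis of_int_eq_iff)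
  then have "even (a\<^sup>2 + a * b + b\<^sup>2)"
    using norm(2) q(1) by simp
  then obtain c d where cd: "a = 2 * c" "b = 2 * d"
    by (auto simp: even_add even_mult_iff power2_eq_square elim!: evenE)
  obtain h where h: "q = 2 * h"
    using q(1) by auto
  have "of_int (int q * c) *\<^sub>R p + of_int (int q * d) *\<^sub>R p' \<in> L"
    using gen unfolding discriminant_generators_def by (metis dvd_triv_left)
  moreover have "(of_nat q / 2) *\<^sub>R v = of_int (int h) *\<^sub>R (v - (of_int a *\<^sub>R p + of_int b *\<^sub>R p'))
      + (of_int (int q * c) *\<^sub>R p + of_int (int q * d) *\<^sub>R p')"
    by (simp add: h cd algebra_simps)
  ultimately show ?thesis
    using add_mem scale_mem[OF ab] by metis
qed

text \<open>The Gram matrix is \<open>2\<^sup>r\<close> times an even unimodular matrix with entries \<open>2a, \<beta>, 2c\<close>.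
  As \<open>\<beta>\<^sup>2 \<equiv> 1\<close> modulo 8, one of \<open>a\<close>, \<open>c\<close> is even, so an element of order \<open>2\<^sup>r\<close> has half norm in
  \<open>2\<int>/2\<^sup>r\<close>.\<close>

lemma rank_ne_2_if_generators:
  assumes bs: "lattice_basis L bs" and det: "Determinant.det (gram_matrix B bs) \<noteq> 0"
    and r: "r > 0" "q = 2 ^ r"
    and gen: "discriminant_generators L B q (\<lambda>x y. x\<^sup>2 + x * y + y\<^sup>2) p p'"
  shows "length bs \<noteq> 2"
proof
  assume "length bs = 2"
  then obtain b1 b2 where bs_eq: "bs = [b1, b2]"
    by (auto simp: numeral_2_eq_2 length_Suc_conv)
  have q: "even q" "q > 0"
    using r by simp_all
  have mem: "x *\<^sub>R b1 + y *\<^sub>R b2 \<in> L \<longleftrightarrow> x \<in> \<int> \<and> y \<in> \<int>" for x y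
  proof -
    have "(\<forall>i<2. [x, y] ! i \<in> \<int>) \<longleftrightarrow> x \<in> \<int> \<and> y \<in> \<int>"
      by (auto simp: numeral_2_eq_2 less_Suc_eq)
    then show ?thesis
      using lattice_basis_sum_mem_iff[OF bs, of "\<lambda>i. [x, y] ! i"]
      by (simp add: bs_eq numeral_2_eq_2)
  qed
  have coord: "\<exists>i j :: int. u = of_int i *\<^sub>R b1 + of_int j *\<^sub>R b2" if "u \<in> L" for u
  proof -
    obtain c :: "nat \<Rightarrow> int" where "u = (\<Sum>i<length bs. of_int (c i) *\<^sub>R (bs ! i))"
      using bs \<open>u \<in> L\<close> by (auto simp: lattice_basis_def)
    then have "u = of_int (c 0) *\<^sub>R b1 + of_int (c 1) *\<^sub>R b2"
      by (simp add: bs_eq)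
    then show ?thesis
      by blast
  qed
  have b: "b1 \<in> L" "b2 \<in> L"
    using mem[of 1 0] mem[of 0 1] by simp_all
  from generators_half[OF q gen] obtain w w' where w: "w \<in> L" "w' \<in> L"
    and wB: "\<And>u. u \<in> L \<Longrightarrow> \<exists>m::int. B w u = of_nat q * of_int m"
    and w'B: "\<And>u. u \<in> L \<Longrightarrow> \<exists>m::int. B w' u = of_nat q * of_int m"
    and half: "\<And>a b :: int. (of_int a / 2) *\<^sub>R w + (of_int b / 2) *\<^sub>R w' \<in> L \<longleftrightarrow> even a \<and> even b"
    by metis
  obtain c1 c2 d1 d2 :: int
    where wc: "w = of_int c1 *\<^sub>R b1 + of_int c2 *\<^sub>R b2"
      and wd: "w' = of_int d1 *\<^sub>R b1 + of_int d2 *\<^sub>R b2"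
    using coord w by metis
  \<comment> \<open>The absolute value of \<delta> is the index in \<open>L\<close> of the
    sublattice spanned by \<open>w\<close> and \<open>w'\<close>. It is odd by independence modulo
    2, so Cramer's rule carries divisibility by \<open>q\<close> over from pairings of
    \<open>w\<close> and \<open>w'\<close> to those of \<open>b1\<close> and
    \<open>b2\<close>.\<close>
  define \<delta> where "\<delta> = c1 * d2 - c2 * d1"
  have comb: "(of_int i / 2) *\<^sub>R w + (of_int j / 2) *\<^sub>R w' = (of_int (i * c1 + j * d1) / 2) *\<^sub>R b1
      + (of_int (i * c2 + j * d2) / 2) *\<^sub>R b2" for i j
    by (simp add: wc wd add_divide_distrib algebra_simps)
  have indep: "even (i * c1 + j * d1) \<and> even (i * c2 + j * d2) \<longleftrightarrow> even i \<and> even j" for i j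
    using half[of i j] unfolding comb mem of_int_half_in_Ints_iff .
  have "odd \<delta>"
    using indep[of 1 0] indep[of 0 1] indep[of 1 1] by (auto simp: \<delta>_def)
  then have coprime: "coprime (int q) \<delta>"
    by (simp add: r)
  have \<delta>b: "of_int \<delta> *\<^sub>R b1 = of_int d2 *\<^sub>R w - of_int c2 *\<^sub>R w'"
    "of_int \<delta> *\<^sub>R b2 = of_int c1 *\<^sub>R w' - of_int d1 *\<^sub>R w"
    by (simp_all add: \<delta>_def wc wd algebra_simps)
  have divisible: "\<exists>m::int. B b u = of_nat q * of_int m" if b': "b \<in> {b1, b2}" and u: "u \<in> L" for b u
  proof -
    obtain m m' :: int where m: "B w u = of_nat q * of_int m" "B w' u = of_nat q * of_int m'"
      using wB w'B u by metis
    have "b \<in> L"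
      using b b' by auto
    then obtain g :: int where g: "B b u = of_int g"
      using form_int u by (metis Ints_cases)
    have "\<exists>n::int. B (of_int \<delta> *\<^sub>R b) u = of_nat q * of_int n"
      using b'
    proof safe
      show "\<exists>n::int. B (of_int \<delta> *\<^sub>R b1) u = of_nat q * of_int n"
        unfolding \<delta>b by (rule exI[of _ "d2 * m - c2 * m'"]) (simp add: form_simps m algebra_simps)
      show "\<exists>n::int. B (of_int \<delta> *\<^sub>R b2) u = of_nat q * of_int n"
        unfolding \<delta>b by (rule exI[of _ "c1 * m' - d1 * m"]) (simp add: form_simps m algebra_simps)
    qed
    then obtain n :: int where "of_int (\<delta> * g) = real_of_int (int q * n)"
      by (auto simp: form_simps g)
    then have "int q dvd \<delta> * g"
      by (metis dvd_triv_left of_int_eq_iff)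
    then have "int q dvd g"
      using coprime coprime_dvd_mult_right_iff by blast
    then show ?thesis
      by (auto simp: g)
  qed
  obtain \<alpha> \<beta> \<gamma> :: int where gram: "B b1 b1 = of_nat q * of_int \<alpha>" "B b1 b2 = of_nat q * of_int \<beta>"
      "B b2 b2 = of_nat q * of_int \<gamma>"
    using divisible b by (metis insertCI)
  note gram' = gram sym[of b2 b1]
  define \<Delta> where "\<Delta> = \<alpha> * \<gamma> - \<beta>\<^sup>2"
  have "Determinant.det (gram_matrix B bs) = (of_nat q)\<^sup>2 * of_int \<Delta>"
    by (simp add: bs_eq det_gram_matrix_2 gram' \<Delta>_def power2_eq_square algebra_simps)
  then have "\<Delta> \<noteq> 0"
    using det by auto
  have dualI: "x *\<^sub>R b1 + y *\<^sub>R b2 \<in> dual"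
    if 1: "of_nat q * (x * of_int \<alpha> + y * of_int \<beta>) \<in> \<int>"
      and 2: "of_nat q * (x * of_int \<beta> + y * of_int \<gamma>) \<in> \<int>" for x y
    unfolding dual_lattice_def
  proof safe
    show "x *\<^sub>R b1 + y *\<^sub>R b2 \<in> span L"
      using b by (intro span_add span_scale span_base)
    fix u assume "u \<in> L"
    then obtain i j :: int where u: "u = of_int i *\<^sub>R b1 + of_int j *\<^sub>R b2"
      using coord by blast
    have "B (x *\<^sub>R b1 + y *\<^sub>R b2) u = of_int i * (of_nat q * (x * of_int \<alpha> + y * of_int \<beta>))
        + of_int j * (of_nat q * (x * of_int \<beta> + y * of_int \<gamma>))"
      by (simp add: u form_simps gram' algebra_simps)
    then show "B (x *\<^sub>R b1 + y *\<^sub>R b2) u \<in> \<int>"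
      using 1 2 by (metis Ints_add Ints_mult Ints_of_int)
  qed
  have scaled_mem: "of_nat q * x \<in> \<int> \<and> of_nat q * y \<in> \<int>" if "x *\<^sub>R b1 + y *\<^sub>R b2 \<in> dual" for x y
    using generators_scale_mem[OF gen that] mem[of "of_nat q * x" "of_nat q * y"]
    by (simp add: scaleR_add_right)
  \<comment> \<open>The two vectors used here are the dual basis, read off from the inverse Gram
    matrix. Their multiples by \<open>q\<close> lie in \<open>L\<close>, so \<Delta> divides every
    entry of the adjugate.\<close>
  have \<Delta>_dvd: "\<Delta> dvd \<alpha>" "\<Delta> dvd \<beta>" "\<Delta> dvd \<gamma>"
  proof -
    have "(of_int \<gamma> / (of_nat q * of_int \<Delta>)) *\<^sub>R b1 + (- of_int \<beta> / (of_nat q * of_int \<Delta>)) *\<^sub>R b2 \<in> dual"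
    proof (rule dualI)
      have "of_nat q * (of_int \<gamma> / (of_nat q * of_int \<Delta>) * of_int \<alpha>
          + - of_int \<beta> / (of_nat q * of_int \<Delta>) * of_int \<beta>) = (of_int \<Delta> / of_int \<Delta> :: real)"
        using q by (simp add: \<Delta>_def field_simps power2_eq_square)
      then show "of_nat q * (of_int \<gamma> / (of_nat q * of_int \<Delta>) * of_int \<alpha>
          + - of_int \<beta> / (of_nat q * of_int \<Delta>) * of_int \<beta>) \<in> (\<int> :: real set)"
        using \<open>\<Delta> \<noteq> 0\<close> by simp
    qed (simp add: mult.commute)
    then have "of_int \<gamma> / real_of_int \<Delta> \<in> \<int>" "- of_int \<beta> / real_of_int \<Delta> \<in> \<int>"
      using scaled_mem q(2) by fastforce+
    then show "\<Delta> dvd \<beta>" "\<Delta> dvd \<gamma>"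
      using \<open>\<Delta> \<noteq> 0\<close> by (auto simp: of_int_div_of_int_in_Ints_iff)
    have "(- of_int \<beta> / (of_nat q * of_int \<Delta>)) *\<^sub>R b1 + (of_int \<alpha> / (of_nat q * of_int \<Delta>)) *\<^sub>R b2 \<in> dual"
    proof (rule dualI)
      have "of_nat q * (- of_int \<beta> / (of_nat q * of_int \<Delta>) * of_int \<beta>
          + of_int \<alpha> / (of_nat q * of_int \<Delta>) * of_int \<gamma>) = (of_int \<Delta> / of_int \<Delta> :: real)"
        using q by (simp add: \<Delta>_def field_simps power2_eq_square)
      then show "of_nat q * (- of_int \<beta> / (of_nat q * of_int \<Delta>) * of_int \<beta>
          + of_int \<alpha> / (of_nat q * of_int \<Delta>) * of_int \<gamma>) \<in> (\<int> :: real set)"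
        using \<open>\<Delta> \<noteq> 0\<close> by simp
    qed (simp add: mult.commute)
    then have "of_int \<alpha> / real_of_int \<Delta> \<in> \<int>"
      using scaled_mem q(2) by fastforce
    then show "\<Delta> dvd \<alpha>"
      using \<open>\<Delta> \<noteq> 0\<close> by (simp add: of_int_div_of_int_in_Ints_iff)
  qed
  \<comment> \<open>Both products in the determinant contain \<Delta> twice, so the square of
    \<Delta> divides \<Delta>.\<close>
  have "\<Delta> * \<Delta> dvd \<alpha> * \<gamma> - \<beta> * \<beta>"
    by (intro dvd_diff mult_dvd_mono \<Delta>_dvd)
  then have "\<Delta> * \<Delta> dvd \<Delta> * 1"
    by (simp add: \<Delta>_def power2_eq_square)
  then have unit: "\<Delta> = 1 \<or> \<Delta> = -1"
    using \<open>\<Delta> \<noteq> 0\<close> by auto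
  have dual: "(1 / of_nat q) *\<^sub>R b1 \<in> dual" "(1 / of_nat q) *\<^sub>R b2 \<in> dual"
    using dualI[of "1 / of_nat q" 0] dualI[of 0 "1 / of_nat q"] q by simp_all
  have norm: "of_nat q * (B ((1 / of_nat q) *\<^sub>R b1) ((1 / of_nat q) *\<^sub>R b1) / 2) = of_int \<alpha> / 2"
    "of_nat q * (B ((1 / of_nat q) *\<^sub>R b2) ((1 / of_nat q) *\<^sub>R b2) / 2) = of_int \<gamma> / 2"
    using q by (simp_all add: form_simps gram)
  \<comment> \<open>Evenness of \<open>L\<close> only says that q \<alpha> and q \<gamma> are even,
    which is void for even \<open>q\<close>. The parity of \<alpha> and \<gamma> comes from the
    isometry: half norms of dual vectors lie in (1/q)Z.\<close>
  have "of_int \<alpha> / (2::real) \<in> \<int>" "of_int \<gamma> / (2::real) \<in> \<int>"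
    using generators_form_scaled[OF q(2) gen dual(1)] generators_form_scaled[OF q(2) gen dual(2)]
    unfolding norm by (metis Ints_of_int)+
  then obtain a c where ac: "\<alpha> = 2 * a" "\<gamma> = 2 * c"
    unfolding of_int_half_in_Ints_iff by blast
  have "odd \<Delta>"
    using unit by auto
  then have "odd \<beta>"
    by (simp add: \<Delta>_def ac)
  then obtain s where s: "\<beta> = 2 * s + 1"
    by (auto elim: oddE)
  have "even (s * (s + 1))"
    by simp
  then obtain t where "s * (s + 1) = 2 * t"
    by blast
  then have "\<beta>\<^sup>2 = 8 * t + 1"
    by (simp add: s power2_eq_square algebra_simps)
  then have "4 * (a * c) - (8 * t + 1) = 1 \<or> 4 * (a * c) - (8 * t + 1) = -1"
    using unit by (simp add: \<Delta>_def ac)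
  \<comment> \<open>The value 1 is impossible modulo 4; the value -1 gives
    \<open>z = 2 * t\<close>.\<close>
  moreover have "even z" if "4 * z - (8 * t + 1) = 1 \<or> 4 * z - (8 * t + 1) = -1" for z
    using that by presburger
  ultimately have "even (a * c)"
    by blast
  \<comment> \<open>The multiple of b1/q by q/2 is b1/2, which would lie in \<open>L\<close> if
    \<open>a\<close> were even; likewise for \<open>b2\<close> and \<open>c\<close>.\<close>
  moreover have "(1 / 2) *\<^sub>R b1 \<notin> L" "(1 / 2) *\<^sub>R b2 \<notin> L"
    using mem[of "1 / 2" 0] mem[of 0 "1 / 2"] of_int_half_in_Ints_iff[of 1] by simp_all
  ultimately show False
    using half_scale_mem_if_even_norm[OF q gen dual(1), of a]
      half_scale_mem_if_even_norm[OF q gen dual(2), of c] norm q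
    by (auto simp: ac)
qed

end

section \<open>Standard lattices with a Gram matrix\<close>

lemma vector_4 [simp]:
  "(vector [x, y, z, w] :: ('a::zero)^4) $ 1 = x"
  "(vector [x, y, z, w] :: ('a::zero)^4) $ 2 = y"
  "(vector [x, y, z, w] :: ('a::zero)^4) $ 3 = z"
  "(vector [x, y, z, w] :: ('a::zero)^4) $ 4 = w"
  unfolding vector_def by simp_all

lemma axis_sum_expansion: "(\<Sum>k\<in>UNIV. x $ k *\<^sub>R axis k 1) = (x :: real^'n)"
  using basis_expansion[of x] by (simp add: scalar_mult_eq_scaleR)

lemma axis_mem_standard_lattice: "axis k 1 \<in> standard_lattice"
  by (simp add: standard_lattice_def axis_def)

lemma span_standard_lattice: "span standard_lattice = (UNIV :: (real^'n) set)"
proof -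
  have "x \<in> span standard_lattice" for x :: "real^'n"
  proof -
    have "(\<Sum>k\<in>UNIV. x $ k *\<^sub>R axis k 1) \<in> span standard_lattice"
      by (intro span_sum span_scale span_base axis_mem_standard_lattice)
    then show ?thesis
      by (simp add: axis_sum_expansion)
  qed
  then show ?thesis
    by blast
qed

lemma standard_lattice_basis: "\<exists>bs. lattice_basis (standard_lattice :: (real^'n) set) bs"
proof -
  obtain xs :: "'n list" where xs: "set xs = UNIV" "distinct xs"
    using finite_distinct_list[OF finite[of UNIV]] by blast
  define bs where "bs = map (\<lambda>k. axis k (1::real)) xs"
  have bij: "bij_betw ((!) xs) {..<length xs} UNIV"
    using bij_betw_nth[OF xs(2)] xs(1) by auto
  have "distinct bs"
    using xs(2) by (auto simp: bs_def distinct_map inj_on_def axis_eq_axis)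
  moreover have "independent (set bs)"
    by (rule independent_mono[OF independent_Basis]) (auto simp: bs_def axis_in_Basis_iff)
  moreover have "standard_lattice = {\<Sum>i<length bs. of_int (c i) *\<^sub>R (bs ! i) |c :: nat \<Rightarrow> int. True}"
  proof safe
    fix x :: "real^'n" assume "x \<in> standard_lattice"
    then have "of_int \<lfloor>x $ k\<rfloor> = x $ k" for k
      by (simp add: standard_lattice_def)
    then have "x = (\<Sum>k\<in>UNIV. of_int \<lfloor>x $ k\<rfloor> *\<^sub>R axis k 1)"
      by (simp only: axis_sum_expansion)
    also have "\<dots> = (\<Sum>i<length bs. of_int \<lfloor>x $ (xs ! i)\<rfloor> *\<^sub>R (bs ! i))"
      by (subst sum.reindex_bij_betw[OF bij, symmetric]) (simp add: bs_def)
    finally show "\<exists>c :: nat \<Rightarrow> int. x = (\<Sum>i<length bs. of_int (c i) *\<^sub>R (bs ! i)) \<and> True"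
      by (intro exI[of _ "\<lambda>i. \<lfloor>x $ (xs ! i)\<rfloor>"]) simp
  next
    fix c :: "nat \<Rightarrow> int"
    show "(\<Sum>i<length bs. of_int (c i) *\<^sub>R (bs ! i)) \<in> standard_lattice"
      by (auto simp: standard_lattice_def bs_def axis_def intro!: Ints_sum)
  qed
  ultimately show ?thesis
    unfolding lattice_basis_def by blast
qed

lemma bilinear_gram_form: "bilinear (gram_form G)"
  by (auto simp: bilinear_def gram_form_def matrix_vector_right_distrib inner_left_distrib
      inner_right_distrib matrix_vector_mult_scaleR intro!: linearI)

lemma gram_form_sym: "transpose G = G \<Longrightarrow> gram_form G x y = gram_form G y x"
  unfolding gram_form_def by (metis dot_lmul_matrix inner_commute transpose_matrix_vector)

lemma gram_form_axis: "gram_form G (axis k 1) y = (G *v y) $ k"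
  by (simp add: gram_form_def inner_axis')

text \<open>The basis comes from an arbitrary enumeration of the index type, so nondegeneracy is
  reduced to injectivity of \<open>G\<close>, which can be checked coordinatewise.\<close>

lemma standard_lattice_even_nondegenerate:
  fixes G :: "real^'n^'n"
  assumes "transpose G = G"
    and int: "\<And>y i. y \<in> standard_lattice \<Longrightarrow> (G *v y) $ i \<in> \<int>"
    and even: "\<And>y. y \<in> standard_lattice \<Longrightarrow> \<exists>k::int. gram_form G y y = 2 * of_int k"
    and inj: "\<And>y. G *v y = 0 \<Longrightarrow> y = 0"
  shows "even_nondegenerate_lattice standard_lattice (gram_form G)"
proof -
  obtain bs where bs: "lattice_basis (standard_lattice :: (real^'n) set) bs"
    using standard_lattice_basis by blast
  have "Determinant.det (gram_matrix (gram_form G) bs) \<noteq> 0"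
  proof (rule det_gram_matrix_nonzero[OF bs bilinear_gram_form])
    fix v :: "real^'n" assume "\<And>w. w \<in> standard_lattice \<Longrightarrow> gram_form G w v = 0"
    then have "(G *v v) $ k = 0" for k
      using gram_form_axis axis_mem_standard_lattice by metis
    then have "G *v v = 0"
      by (simp add: Finite_Cartesian_Product.vec_eq_iff)
    then show "v = 0"
      by (rule inj)
  qed
  moreover have "gram_form G x y \<in> \<int>" if "x \<in> standard_lattice" "y \<in> standard_lattice" for x y
    using that int unfolding gram_form_def inner_vec_def
    by (auto simp: standard_lattice_def intro!: Ints_sum Ints_mult)
  ultimately show ?thesis
    using bs even bilinear_gram_form gram_form_sym[OF assms(1)]
    by (auto simp: even_nondegenerate_lattice_def is_lattice_def nondegenerate_def even_form_def)
qed

lemma dual_standard_lattice: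
  fixes G :: "real^'n^'n"
  assumes "transpose G = G"
  shows "dual_lattice standard_lattice (gram_form G) = {v. \<forall>i. (G *v v) $ i \<in> \<int>}"
proof safe
  fix v i assume "v \<in> dual_lattice standard_lattice (gram_form G)"
  then have "gram_form G v (axis i 1) \<in> \<int>"
    using axis_mem_standard_lattice by (auto simp: dual_lattice_def)
  then show "(G *v v) $ i \<in> \<int>"
    by (simp add: gram_form_sym[OF assms, of v] gram_form_axis)
next
  fix v :: "real^'n" assume "\<forall>i. (G *v v) $ i \<in> \<int>"
  then have "gram_form G w v \<in> \<int>" if "w \<in> standard_lattice" for w
    using that unfolding gram_form_def inner_vec_def
    by (auto simp: standard_lattice_def intro!: Ints_sum Ints_mult)
  then show "v \<in> dual_lattice standard_lattice (gram_form G)"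
    by (simp add: dual_lattice_def span_standard_lattice gram_form_sym[OF assms, of v])
qed

lemma eq_divide_of_nat_if:
  fixes s t :: real
  assumes "q > 0" and "of_nat q * t = s"
  shows "t = s / of_nat q"
  using assms by auto

section \<open>The two explicit lattices\<close>

lemma hyperbolic_lattice:
  fixes q :: nat and G :: "real^2^2"
  assumes q: "q > 0" and G: "G = vector [vector [0, of_nat q], vector [of_nat q, 0]]"
  shows "even_nondegenerate_lattice standard_lattice (gram_form G)"
    and "isometrically_isomorphic (discriminant_module standard_lattice (gram_form G)) (module_C q)"
proof -
  have mult: "(G *v y) $ 1 = of_nat q * y $ 2" "(G *v y) $ 2 = of_nat q * y $ 1" for y
    by (simp_all add: G matrix_vector_mult_def sum_2)
  have form: "gram_form G x y = of_nat q * (x $ 1 * y $ 2 + x $ 2 * y $ 1)" for x y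
    by (simp add: gram_form_def inner_vec_def sum_2 mult algebra_simps)
  have symG: "transpose G = G"
    by (simp add: G Finite_Cartesian_Product.vec_eq_iff forall_2 transpose_def)
  show *: "even_nondegenerate_lattice standard_lattice (gram_form G)"
  proof (rule standard_lattice_even_nondegenerate[OF symG])
    fix y :: "real^2"
    show "(G *v y) $ i \<in> \<int>" if "y \<in> standard_lattice" for i
      using that exhaust_2[of i] by (auto simp: mult standard_lattice_def)
    show "\<exists>k::int. gram_form G y y = 2 * of_int k" if "y \<in> standard_lattice"
    proof -
      have "of_nat q * (y $ 1 * y $ 2) \<in> \<int>"
        using that by (simp add: standard_lattice_def)
      then obtain k where "of_nat q * (y $ 1 * y $ 2) = of_int k"
        by (rule Ints_cases)
      then show ?thesis
        by (intro exI[of _ k]) (simp add: form algebra_simps)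
    qed
    show "y = 0" if "G *v y = 0"
    proof -
      have "(G *v y) $ 1 = 0" "(G *v y) $ 2 = 0"
        using that by simp_all
      then show ?thesis
        using q by (simp add: mult Finite_Cartesian_Product.vec_eq_iff forall_2)
    qed
  qed
  interpret even_lattice standard_lattice "gram_form G"
    using * by unfold_locales (auto simp: even_nondegenerate_lattice_def)
  let ?p = "vector [1 / of_nat q, 0] :: real^2" and ?p' = "vector [0, 1 / of_nat q] :: real^2"
  have Ints_iff: "of_int a / of_nat q \<in> (\<int> :: real set) \<longleftrightarrow> int q dvd a" for a
    using of_int_div_of_int_in_Ints_iff[of a "int q", where ?'a = real] q by simp
  have dual_iff: "v \<in> dual \<longleftrightarrow> of_nat q * v $ 1 \<in> \<int> \<and> of_nat q * v $ 2 \<in> \<int>" for v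
    by (auto simp: dual_standard_lattice[OF symG] forall_2 mult)
  have "discriminant_generators standard_lattice (gram_form G) q (\<lambda>x y. x * y) ?p ?p'"
    unfolding discriminant_generators_def
  proof (intro conjI allI ballI impI)
    show "?p \<in> dual" "?p' \<in> dual"
      using q by (simp_all add: dual_iff)
    show "\<exists>a b :: int. v - (of_int a *\<^sub>R ?p + of_int b *\<^sub>R ?p') \<in> standard_lattice" if "v \<in> dual" for v
    proof -
      have "of_nat q * v $ 1 \<in> \<int>" "of_nat q * v $ 2 \<in> \<int>"
        using that by (simp_all add: dual_iff)
      then obtain a b :: int where "of_nat q * v $ 1 = of_int a" "of_nat q * v $ 2 = of_int b"
        by (auto elim!: Ints_cases)
      then have "v $ 1 = of_int a / of_nat q" "v $ 2 = of_int b / of_nat q"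
        by (simp_all only: eq_divide_of_nat_if[OF q])
      then have "v - (of_int a *\<^sub>R ?p + of_int b *\<^sub>R ?p') \<in> standard_lattice"
        by (simp add: standard_lattice_def forall_2)
      then show ?thesis
        by blast
    qed
    show "of_int a *\<^sub>R ?p + of_int b *\<^sub>R ?p' \<in> standard_lattice \<longleftrightarrow> int q dvd a \<and> int q dvd b" for a b
      by (simp add: standard_lattice_def forall_2 Ints_iff)
    show "gram_form G v v / 2 - of_int (a * b) / of_nat q \<in> \<int>"
      if "v = of_int a *\<^sub>R ?p + of_int b *\<^sub>R ?p'" for a b v
      using q by (simp add: that form field_simps)
  qed
  from isometrically_isomorphic_if_generators[OF q this]
  show "isometrically_isomorphic (discriminant_module standard_lattice (gram_form G)) (module_C q)"
    by (simp add: module_C_def quadratic_module_mod_def)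
qed

lemma linear_system_eq_0:
  fixes i j k l s t :: real
  assumes "i * s + j * t = 0" and "k * s + l * t = 0" and "i * l - j * k \<noteq> 0"
  shows "s = 0" and "t = 0"
proof -
  have "(i * l - j * k) * s = l * (i * s + j * t) - j * (k * s + l * t)"
    "(i * l - j * k) * t = i * (k * s + l * t) - k * (i * s + j * t)"
    by (simp_all add: algebra_simps)
  then have "(i * l - j * k) * s = 0" "(i * l - j * k) * t = 0"
    unfolding assms(1,2) by simp_all
  then show "s = 0" "t = 0"
    using assms(3) by simp_all
qed

text \<open>Cramer's rule over the integers, where a determinant of 1 or -1 costs no
  denominator.\<close>

lemma linear_system_Ints:
  fixes s t :: real
  assumes "of_int i * s + of_int j * t \<in> \<int>" and "of_int k * s + of_int l * t \<in> \<int>"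
    and "i * l - j * k = (1::int) \<or> i * l - j * k = -1"
  shows "s \<in> \<int>" and "t \<in> \<int>"
proof -
  have "of_int l * (of_int i * s + of_int j * t) - of_int j * (of_int k * s + of_int l * t) \<in> \<int>"
    "of_int i * (of_int k * s + of_int l * t) - of_int k * (of_int i * s + of_int j * t) \<in> \<int>"
    by (intro Ints_diff Ints_mult[OF Ints_of_int] assms(1,2))+
  moreover have "of_int l * (of_int i * s + of_int j * t) - of_int j * (of_int k * s + of_int l * t)
      = of_int (i * l - j * k) * s"
    "of_int i * (of_int k * s + of_int l * t) - of_int k * (of_int i * s + of_int j * t)
      = of_int (i * l - j * k) * t"
    by (simp_all add: algebra_simps)
  ultimately have "of_int (i * l - j * k) * s \<in> \<int>" "of_int (i * l - j * k) * t \<in> \<int>"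
    by simp_all
  then show "s \<in> \<int>" "t \<in> \<int>"
    using assms(3) by (elim disjE; simp)+
qed

text \<open>The core is \<open>dual_imp\<close>: a dual vector has its first two coordinates in
  (1/q)Z and its last two in Z, so the first two unit vectors divided by \<open>q\<close> generate
  the dual modulo the lattice.\<close>

lemma anisotropic_lattice:
  fixes q :: nat and v x \<epsilon> :: int and G :: "real^4^4"
  assumes q: "q > 0" and \<epsilon>: "\<epsilon> = 1 \<or> \<epsilon> = -1" and x: "3 * x = int q * v\<^sup>2 + \<epsilon>"
    and G: "G = vector [vector [2 * of_nat q, of_nat q, 0, 0],
                        vector [of_nat q, 2 * of_nat q, of_nat q * of_int v, 0],
                        vector [0, of_nat q * of_int v, 2 * of_int x, 1],
                        vector [0, 0, 1, of_int \<epsilon> * 2]]"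
  shows "even_nondegenerate_lattice standard_lattice (gram_form G)"
    and "isometrically_isomorphic (discriminant_module standard_lattice (gram_form G)) (module_B q)"
proof -
  have mult: "(G *v y) $ 1 = 2 * (of_nat q * y $ 1) + of_nat q * y $ 2"
    "(G *v y) $ 2 = of_nat q * y $ 1 + 2 * (of_nat q * y $ 2) + of_nat q * of_int v * y $ 3"
    "(G *v y) $ 3 = of_int v * (of_nat q * y $ 2) + 2 * of_int x * y $ 3 + y $ 4"
    "(G *v y) $ 4 = y $ 3 + 2 * of_int \<epsilon> * y $ 4" for y
    by (simp_all add: G matrix_vector_mult_def sum_4)
  have symG: "transpose G = G"
    by (simp add: G Finite_Cartesian_Product.vec_eq_iff forall_4 transpose_def)
  have form: "gram_form G y y = 2 * (of_nat q * ((y $ 1)\<^sup>2 + y $ 1 * y $ 2 + (y $ 2)\<^sup>2)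
      + of_nat q * of_int v * y $ 2 * y $ 3 + of_int x * (y $ 3)\<^sup>2 + y $ 3 * y $ 4 + of_int \<epsilon> * (y $ 4)\<^sup>2)" for y
    by (simp add: gram_form_def inner_vec_def sum_4 mult power2_eq_square algebra_simps)
  have \<epsilon>2: "\<epsilon> * \<epsilon> = 1"
    using \<epsilon> by auto
  \<comment> \<open>This is the determinant of the system formed by \<open>elim1\<close> and
    \<open>elim2\<close>. The relation defining \<open>x\<close> is exactly what makes it a
    unit.\<close>
  have det: "3 * (1 - 4 * \<epsilon> * x) - (- 4 * \<epsilon> * int q * v) * v = -1"
  proof -
    have "3 * (1 - 4 * \<epsilon> * x) - (- 4 * \<epsilon> * int q * v) * v = 3 - 4 * \<epsilon> * (3 * x - int q * v\<^sup>2)"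
      by (simp add: algebra_simps power2_eq_square)
    also have "\<dots> = 3 - 4 * (\<epsilon> * \<epsilon>)"
      by (simp add: x)
    finally show ?thesis
      by (simp add: \<epsilon>2)
  qed
  \<comment> \<open>Eliminating the first and third coordinates leaves a unimodular \<open>2 \<times> 2\<close> system for
    \<open>q y\<^sub>2\<close> and \<open>y\<^sub>4\<close>.\<close>
  have elim1: "of_int 3 * (of_nat q * y $ 2) + of_int (- 4 * \<epsilon> * int q * v) * y $ 4
      = 2 * (G *v y) $ 2 - (G *v y) $ 1 - 2 * of_nat q * of_int v * (G *v y) $ 4" for y
    by (simp add: mult algebra_simps)
  have elim2: "of_int v * (of_nat q * y $ 2) + of_int (1 - 4 * \<epsilon> * x) * y $ 4
      = (G *v y) $ 3 - 2 * of_int x * (G *v y) $ 4" for y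
    by (simp add: mult algebra_simps)
  have dual_imp: "of_nat q * y $ 1 \<in> \<int> \<and> of_nat q * y $ 2 \<in> \<int> \<and> y $ 3 \<in> \<int> \<and> y $ 4 \<in> \<int>"
    if "\<And>i. (G *v y) $ i \<in> \<int>" for y
  proof -
    have 1: "of_int 3 * (of_nat q * y $ 2) + of_int (- 4 * \<epsilon> * int q * v) * y $ 4 \<in> \<int>"
      unfolding elim1 using that by (intro Ints_diff Ints_mult; simp)
    have 2: "of_int v * (of_nat q * y $ 2) + of_int (1 - 4 * \<epsilon> * x) * y $ 4 \<in> \<int>"
      unfolding elim2 using that by (intro Ints_diff Ints_mult; simp)
    have y24: "of_nat q * y $ 2 \<in> \<int>" "y $ 4 \<in> \<int>"
      using linear_system_Ints[OF 1 2 disjI2[OF det]] by blast+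
    have "y $ 3 = (G *v y) $ 4 - of_int (2 * \<epsilon>) * y $ 4"
      by (simp add: mult)
    then have y3: "y $ 3 \<in> \<int>"
      using that y24 by (metis Ints_diff Ints_mult Ints_of_int)
    \<comment> \<open>The second row is used because q y1 has coefficient 1 there; the first row
      would control only 2 q y1.\<close>
    have "of_nat q * y $ 1 = (G *v y) $ 2 - 2 * (of_nat q * y $ 2) - of_int (int q * v) * y $ 3"
      by (simp add: mult)
    moreover have "\<dots> \<in> \<int>"
      using that y24 y3 by (intro Ints_diff Ints_mult[OF _ y3] Ints_mult[OF _ y24(1)]; simp)
    ultimately show ?thesis
      using y24 y3 by simp
  qed
  show *: "even_nondegenerate_lattice standard_lattice (gram_form G)"
  proof (rule standard_lattice_even_nondegenerate[OF symG])
    fix y :: "real^4"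
    show "(G *v y) $ i \<in> \<int>" if "y \<in> standard_lattice" for i
      using that exhaust_4[of i] by (auto simp: mult standard_lattice_def)
    show "\<exists>k::int. gram_form G y y = 2 * of_int k" if "y \<in> standard_lattice"
    proof -
      have "of_nat q * ((y $ 1)\<^sup>2 + y $ 1 * y $ 2 + (y $ 2)\<^sup>2) + of_nat q * of_int v * y $ 2 * y $ 3
          + of_int x * (y $ 3)\<^sup>2 + y $ 3 * y $ 4 + of_int \<epsilon> * (y $ 4)\<^sup>2 \<in> \<int>"
        using that by (simp add: standard_lattice_def)
      then show ?thesis
        unfolding form by (metis Ints_cases)
    qed
    show "y = 0" if "G *v y = 0"
    proof -
      have Gy: "(G *v y) $ i = 0" for i
        using that by simp
      have 1: "of_int 3 * (of_nat q * y $ 2) + of_int (- 4 * \<epsilon> * int q * v) * y $ 4 = 0"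
        unfolding elim1 by (simp add: Gy)
      have 2: "of_int v * (of_nat q * y $ 2) + of_int (1 - 4 * \<epsilon> * x) * y $ 4 = 0"
        unfolding elim2 by (simp add: Gy)
      have "real_of_int (3 * (1 - 4 * \<epsilon> * x) - (- 4 * \<epsilon> * int q * v) * v) = -1"
        unfolding det by simp
      then have "of_int 3 * of_int (1 - 4 * \<epsilon> * x) - of_int (- 4 * \<epsilon> * int q * v) * of_int v
          \<noteq> (0::real)"
        by simp
      from linear_system_eq_0[OF 1 2 this] have "y $ 2 = 0" "y $ 4 = 0"
        using q by simp_all
      moreover from this have "y $ 3 = 0"
        using Gy[of 4] by (simp add: mult)
      ultimately show ?thesis
        using Gy[of 1] q by (simp add: mult Finite_Cartesian_Product.vec_eq_iff forall_4)
    qed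
  qed
  interpret even_lattice standard_lattice "gram_form G"
    using * by unfold_locales (auto simp: even_nondegenerate_lattice_def)
  let ?p = "vector [1 / of_nat q, 0, 0, 0] :: real^4"
  let ?p' = "vector [0, 1 / of_nat q, 0, 0] :: real^4"
  have Ints_iff: "of_int a / of_nat q \<in> (\<int> :: real set) \<longleftrightarrow> int q dvd a" for a
    using of_int_div_of_int_in_Ints_iff[of a "int q", where ?'a = real] q by simp
  have "discriminant_generators standard_lattice (gram_form G) q (\<lambda>x y. x\<^sup>2 + x * y + y\<^sup>2) ?p ?p'"
    unfolding discriminant_generators_def
  proof (intro conjI allI ballI impI)
    show "?p \<in> dual" "?p' \<in> dual"
      using q by (simp_all add: dual_standard_lattice[OF symG] forall_4 mult)
    show "\<exists>a b :: int. u - (of_int a *\<^sub>R ?p + of_int b *\<^sub>R ?p') \<in> standard_lattice" if "u \<in> dual" for u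
    proof -
      have u: "of_nat q * u $ 1 \<in> \<int> \<and> of_nat q * u $ 2 \<in> \<int> \<and> u $ 3 \<in> \<int> \<and> u $ 4 \<in> \<int>"
        using that by (intro dual_imp) (simp add: dual_standard_lattice[OF symG])
      then obtain a b :: int where "of_nat q * u $ 1 = of_int a" "of_nat q * u $ 2 = of_int b"
        by (metis Ints_cases)
      then have "u $ 1 = of_int a / of_nat q" "u $ 2 = of_int b / of_nat q"
        by (simp_all only: eq_divide_of_nat_if[OF q])
      then have "u - (of_int a *\<^sub>R ?p + of_int b *\<^sub>R ?p') \<in> standard_lattice"
        using u by (simp add: standard_lattice_def forall_4)
      then show ?thesis
        by blast
    qed
    show "of_int a *\<^sub>R ?p + of_int b *\<^sub>R ?p' \<in> standard_lattice \<longleftrightarrow> int q dvd a \<and> int q dvd b" for a b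
      by (simp add: standard_lattice_def forall_4 Ints_iff)
    show "gram_form G u u / 2 - of_int (a\<^sup>2 + a * b + b\<^sup>2) / of_nat q \<in> \<int>"
      if "u = of_int a *\<^sub>R ?p + of_int b *\<^sub>R ?p'" for a b u
    proof -
      have "gram_form G u u / 2 = of_int (a\<^sup>2 + a * b + b\<^sup>2) / of_nat q"
        using q by (simp add: that form field_simps power2_eq_square)
      then show ?thesis
        by (simp only: diff_self Ints_0)
    qed
  qed
  from isometrically_isomorphic_if_generators[OF q this]
  show "isometrically_isomorphic (discriminant_module standard_lattice (gram_form G)) (module_B q)"
    by (simp add: module_B_def quadratic_module_mod_def)
qed

section \<open>Minimal ranks and the theorem\<close>

lemma rank_ge_2_if_discriminant_C:
  assumes r: "r > 0" and L: "even_nondegenerate_lattice L B"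
    and iso: "isometrically_isomorphic (discriminant_module L B) (module_C (2 ^ r))"
  shows "lattice_rank L \<ge> 2"
proof -
  interpret even_lattice L B
    using L by unfold_locales (auto simp: even_nondegenerate_lattice_def)
  obtain bs where bs: "lattice_basis L bs"
    using lattice by (auto simp: is_lattice_def)
  have iso': "isometrically_isomorphic (discriminant_module L B) (quadratic_module_mod (2 ^ r) (\<lambda>x y. x * y))"
    using iso by (simp add: module_C_def quadratic_module_mod_def)
  have "[(a mod int (2 ^ r)) * (b mod int (2 ^ r)) = a * b] (mod int (2 ^ r))" for a b
    by (intro cong_mult) (simp_all add: cong_def)
  then obtain p p' where "discriminant_generators L B (2 ^ r) (\<lambda>x y. x * y) p p'"
    using generators_if_isometrically_isomorphic[OF _ _ iso'] by (metis zero_less_power zero_less_numeral)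
  then show ?thesis
    using rank_ge_2_if_generators[OF bs, of "2 ^ r"] r by (simp add: lattice_rank_eq[OF bs])
qed

lemma rank_ge_4_if_discriminant_B:
  assumes r: "r > 0" and L: "even_nondegenerate_lattice L B"
    and iso: "isometrically_isomorphic (discriminant_module L B) (module_B (2 ^ r))"
  shows "lattice_rank L \<ge> 4"
proof -
  interpret even_lattice L B
    using L by unfold_locales (auto simp: even_nondegenerate_lattice_def)
  \<comment> \<open>The basis is taken from nondegeneracy, since excluding rank 2 uses its Gram
    determinant.\<close>
  obtain bs where bs: "lattice_basis L bs" and det: "Determinant.det (gram_matrix B bs) \<noteq> 0"
    using L by (auto simp: even_nondegenerate_lattice_def nondegenerate_def)
  have iso': "isometrically_isomorphic (discriminant_module L B)
      (quadratic_module_mod (2 ^ r) (\<lambda>x y. x\<^sup>2 + x * y + y\<^sup>2))"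
    using iso by (simp add: module_B_def quadratic_module_mod_def)
  have "[(a mod int (2 ^ r))\<^sup>2 + (a mod int (2 ^ r)) * (b mod int (2 ^ r)) + (b mod int (2 ^ r))\<^sup>2
      = a\<^sup>2 + a * b + b\<^sup>2] (mod int (2 ^ r))" for a b
    by (intro cong_add cong_mult cong_pow) (simp_all add: cong_def)
  then obtain p p' where gen: "discriminant_generators L B (2 ^ r) (\<lambda>x y. x\<^sup>2 + x * y + y\<^sup>2) p p'"
    using generators_if_isometrically_isomorphic[OF _ _ iso'] by (metis zero_less_power zero_less_numeral)
  have "length bs \<ge> 2" "length bs \<noteq> 3" "length bs \<noteq> 2"
    using rank_ge_2_if_generators[OF bs _ _ gen] rank_ne_3_if_generators[OF bs _ _ gen]
      rank_ne_2_if_generators[OF bs det r refl gen] r by simp_all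
  then show ?thesis
    by (simp add: lattice_rank_eq[OF bs])
qed

theorem theorem4p7:
  fixes r :: nat and \<epsilon> :: int
  assumes "r > 0" and "\<epsilon> = (-1) ^ (r + 1)"
  shows
    "(\<forall>(v::int) (x::real).
        [2 ^ r * v\<^sup>2 = - \<epsilon>] (mod 3) \<longrightarrow> x = (2 ^ r * (of_int v)\<^sup>2 + of_int \<epsilon>) / 3 \<longrightarrow>
        (let G = vector [vector [2 ^ (r + 1), 2 ^ r, 0, 0],
                         vector [2 ^ r, 2 ^ (r + 1), 2 ^ r * of_int v, 0],
                         vector [0, 2 ^ r * of_int v, 2 * x, 1],
                         vector [0, 0, 1, of_int \<epsilon> * 2]] :: real^4^4
         in even_nondegenerate_lattice standard_lattice (gram_form G) \<and>
            isometrically_isomorphic (discriminant_module standard_lattice (gram_form G))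
              (module_B (2 ^ r))) \<and>
        \<not> (\<exists>(L :: 'v::real_vector set) B. even_nondegenerate_lattice L B \<and> lattice_rank L < 4 \<and>
              isometrically_isomorphic (discriminant_module L B) (module_B (2 ^ r))))
   \<and> ((let G = vector [vector [0, 2 ^ r], vector [2 ^ r, 0]] :: real^2^2
        in even_nondegenerate_lattice standard_lattice (gram_form G) \<and>
           isometrically_isomorphic (discriminant_module standard_lattice (gram_form G))
             (module_C (2 ^ r))) \<and>
       \<not> (\<exists>(L :: 'v set) B. even_nondegenerate_lattice L B \<and> lattice_rank L < 2 \<and>
             isometrically_isomorphic (discriminant_module L B) (module_C (2 ^ r))))"
proof -
  have \<epsilon>: "\<epsilon> = 1 \<or> \<epsilon> = -1"
    unfolding assms(2) by (cases "even (r + 1)") auto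
  have B: "even_nondegenerate_lattice standard_lattice (gram_form G) \<and>
      isometrically_isomorphic (discriminant_module standard_lattice (gram_form G)) (module_B (2 ^ r))"
    if v: "[2 ^ r * v\<^sup>2 = - \<epsilon>] (mod 3)" and x: "x = (2 ^ r * (of_int v)\<^sup>2 + of_int \<epsilon>) / 3"
      and G: "G = vector [vector [2 ^ (r + 1), 2 ^ r, 0, 0],
                          vector [2 ^ r, 2 ^ (r + 1), 2 ^ r * of_int v, 0],
                          vector [0, 2 ^ r * of_int v, 2 * x, 1],
                          vector [0, 0, 1, of_int \<epsilon> * 2]]"
    for v x and G :: "real^4^4"
  proof -
    \<comment> \<open>The congruence turns the real quotient \<open>x\<close> into an integer, as
      \<open>anisotropic_lattice\<close> expects.\<close>
    obtain k where k: "2 ^ r * v\<^sup>2 + \<epsilon> = 3 * k"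
      using v by (auto simp: cong_iff_dvd_diff)
    then have "2 ^ r * (of_int v)\<^sup>2 + of_int \<epsilon> = 3 * real_of_int k"
      using arg_cong[OF k, of real_of_int] by simp
    then have xk: "x = of_int k"
      by (simp add: x)
    have "3 * k = int (2 ^ r) * v\<^sup>2 + \<epsilon>"
      using k by simp
    note * = anisotropic_lattice[of "2 ^ r", OF _ \<epsilon> this, of G]
    show ?thesis
      by (intro conjI *) (simp_all add: G xk)
  qed
  have C: "even_nondegenerate_lattice standard_lattice (gram_form G) \<and>
      isometrically_isomorphic (discriminant_module standard_lattice (gram_form G)) (module_C (2 ^ r))"
    if "G = vector [vector [0, 2 ^ r], vector [2 ^ r, 0]]" for G :: "real^2^2"
    using hyperbolic_lattice[of "2 ^ r" G] that by simp
  show ?thesis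
    unfolding Let_def
    using B C rank_ge_4_if_discriminant_B[OF assms(1)] rank_ge_2_if_discriminant_C[OF assms(1)]
    by (meson not_le)
qed

end
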